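(* Let $(V,g)$ be a Euclidean real vector space of dimension $n$. With respect to the orthogonal decomposition $D^{p,p}=E^{p,p}\oplus gE^{p-1,p-1}\oplus g^2E^{p-2,p-2}\oplus\dots\oplus g^pD^{0,0}$, each $\omega\in D^{p,p}$ is decomposed as follows: $$\omega=\omega_p+g\,\omega_{p-1}+\dots+g^p\omega_0,\qquad \omega_k\in E^{k,k},$$ where $$\omega_k=\frac{(n-p-k)!}{(p-k)!\,(n-2k)!}\left[c^{p-k}(\omega)+\sum_{r=1}^k\frac{(-1)^r}{\prod_{i=0}^{r-1}(n-2k+2+i)}\,\frac{g^r}{r!}\,c^{p-k+r}(\omega)\right].$$
   Context: $D^{p,q}=\Lambda^pV^*\otimes\Lambda^qV^*$, identified with bilinear forms $\Lambda^pV\times\Lambda^qV\to\mathbb R$ (wedges of distinct elements of a dual basis evaluate to $1$ on the corresponding wedges of basis vectors). The product is $(\theta_1\otimes\theta_2)\cdot(\theta_3\otimes\theta_4)=(\theta_1\wedge\theta_3)\otimes(\theta_2\wedge\theta_4)$, and $g=\sum_{i=1}^n e_i\otimes e_i\in D^{1,1}$ for an orthonormal basis $(e_i)$ of $V^*$. The contraction $c:D^{p,q}\to D^{p-1,q-1}$ is $0$ if $p=0$ or $q=0$, and otherwise $c\omega(x_1\wedge\dots\wedge x_{p-1},y_1\wedge\dots\wedge y_{q-1})=\sum_{j=1}^n\omega(e_j\wedge x_1\wedge\dots\wedge x_{p-1},e_j\wedge y_1\wedge\dots\wedge y_{q-1})$ with $(e_j)$ an orthonormal basis of $V$. $E^{p,q}=\ker(c)\cap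 D^{p,q}$ is the space of effective elements of $D^{p,q}$ ($E^{0,0}=D^{0,0}=\mathbb R$). Orthogonality refers to the inner product on $D^{p,q}$ induced by the standard inner products on $\Lambda^pV^*$ and $\Lambda^qV^*$.
   Formalization: The formula for ω_k is asserted for p+k ≤ n; when p+k > n it contains the factorial of the negative number n−p−k and is undefined, and there ω_k is taken to be 0 (in these cases g^{p−k}E^{k,k} = 0). For 2p ≤ n nothing changes. *)

theory Defs
  imports "HOL-Analysis.Analysis"
begin

text \<open>
  A finite-dimensional real inner product space V is a type of class \<^class>\<open>real_inner\<close>
  together with a finite orthonormal basis. (The class \<^class>\<open>euclidean_space\<close> would
  exclude dimension 0.)
\<close>

definition orthonormal_basis :: "'a::real_inner set \<Rightarrow> bool" where
  "orthonormal_basis B \<longleftrightarrow>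
     finite B \<and> span B = UNIV \<and> (\<forall>a\<in>B. \<forall>b\<in>B. a \<bullet> b = (if a = b then 1 else 0))"

text \<open>
  By the universal property of the exterior power, an element of the \<open>p\<close>-th exterior power
  of the dual of V is an alternating \<open>p\<close>-linear form on V. Its value on
  \<open>x\<^sub>1 \<and> \<dots> \<and> x\<^sub>p\<close> is the value on the list \<open>[x\<^sub>1, \<dots>, x\<^sub>p]\<close>; on lists of any other length
  a \<open>p\<close>-form is 0, so that forms of all degrees are functions of the same type.
\<close>

type_synonym 'a form = "'a list \<Rightarrow> real"
type_synonym 'a double_form = "'a list \<Rightarrow> 'a list \<Rightarrow> real"

definition alt_forms :: "nat \<Rightarrow> 'a::real_vector form set" where
  "alt_forms p = {\<alpha>.
     (\<forall>xs. length xs \<noteq> p \<longrightarrow> \<alpha> xs = 0) \<and>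
     (\<forall>xs i. length xs = p \<and> i < p \<longrightarrow> linear (\<lambda>x. \<alpha> (xs[i := x]))) \<and>
     (\<forall>xs. \<not> distinct xs \<longrightarrow> \<alpha> xs = 0)}"

text \<open>The space \<open>D\<^sup>p\<^sup>,\<^sup>q\<close> of bilinear forms on the product of the \<open>p\<close>-th and \<open>q\<close>-th exterior powers of V.\<close>

definition double_forms :: "nat \<Rightarrow> nat \<Rightarrow> 'a::real_vector double_form set" where
  "double_forms p q =
     {\<omega>. (\<forall>ys. (\<lambda>xs. \<omega> xs ys) \<in> alt_forms p) \<and> (\<forall>xs. \<omega> xs \<in> alt_forms q)}"

definition tensor :: "'a form \<Rightarrow> 'a form \<Rightarrow> 'a double_form" where
  "tensor \<alpha> \<beta> = (\<lambda>xs ys. \<alpha> xs * \<beta> ys)"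

text \<open>
  The exterior product as a sum over shuffles: the entries of \<open>xs\<close> at the positions in \<open>I\<close> are
  given to the first factor and the others, in order, to the second. The sign is that of the
  permutation moving the positions in \<open>I\<close> to the front. For forms of degrees \<open>p\<close> and \<open>r\<close> only the
  sets \<open>I\<close> of cardinality \<open>p\<close> contribute, and only on lists of length \<open>p + r\<close>.
\<close>

definition shuffle_sign :: "nat set \<Rightarrow> real" where
  "shuffle_sign I = (-1) ^ card {(i, j). i \<in> I \<and> j \<notin> I \<and> j < i}"

definition wedge :: "'a form \<Rightarrow> 'a form \<Rightarrow> 'a form" where
  "wedge \<alpha> \<beta> = (\<lambda>xs.
     \<Sum>I\<in>Pow {..<length xs}. shuffle_sign I * \<alpha> (nths xs I) * \<beta> (nths xs (- I)))"

text \<open>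
  The product of double forms: the bilinear extension of
  \<open>(\<theta>\<^sub>1 \<otimes> \<theta>\<^sub>2) \<cdot> (\<theta>\<^sub>3 \<otimes> \<theta>\<^sub>4) = (\<theta>\<^sub>1 \<and> \<theta>\<^sub>3) \<otimes> (\<theta>\<^sub>2 \<and> \<theta>\<^sub>4)\<close>, see \<open>dform_mult_tensor\<close> below.
\<close>

definition dform_mult :: "'a double_form \<Rightarrow> 'a double_form \<Rightarrow> 'a double_form" where
  "dform_mult \<omega> \<theta> = (\<lambda>xs ys.
     \<Sum>I\<in>Pow {..<length xs}. \<Sum>J\<in>Pow {..<length ys}.
       shuffle_sign I * shuffle_sign J *
       \<omega> (nths xs I) (nths ys J) * \<theta> (nths xs (- I)) (nths ys (- J)))"

lemma dform_mult_tensor: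
  "dform_mult (tensor \<theta>1 \<theta>2) (tensor \<theta>3 \<theta>4) = tensor (wedge \<theta>1 \<theta>3) (wedge \<theta>2 \<theta>4)"
  by (simp add: dform_mult_def tensor_def wedge_def sum_product mult_ac)

text \<open>The unit of the algebra of double forms, i.e. the element 1 of \<open>D\<^sup>0\<^sup>,\<^sup>0 = \<real>\<close>.\<close>

definition form_one :: "'a form" where
  "form_one xs = (if xs = [] then 1 else 0)"

definition dform_one :: "'a double_form" where
  "dform_one = tensor form_one form_one"

text \<open>The element of the dual space represented by \<open>b\<close>; for \<open>b\<close> in an orthonormal basis these
  form the dual basis.\<close>

definition covector :: "'a::real_inner \<Rightarrow> 'a form" where
  "covector b = (\<lambda>xs. if length xs = 1 then b \<bullet> hd xs else 0)"

definition metric :: "'a::real_inner set \<Rightarrow> 'a double_form" where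
  "metric B = (\<lambda>xs ys. \<Sum>b\<in>B. tensor (covector b) (covector b) xs ys)"

definition metric_power :: "'a::real_inner set \<Rightarrow> nat \<Rightarrow> 'a double_form" where
  "metric_power B r = (dform_mult (metric B) ^^ r) dform_one"

text \<open>
  On \<open>D\<^sup>p\<^sup>,\<^sup>q\<close> with \<open>p = 0\<close> or \<open>q = 0\<close> the formula below gives 0, since such forms vanish on pairs
  of nonempty lists.
\<close>

definition contraction :: "'a set \<Rightarrow> 'a double_form \<Rightarrow> 'a double_form" where
  "contraction B \<omega> = (\<lambda>xs ys. \<Sum>e\<in>B. \<omega> (e # xs) (e # ys))"

definition effective_forms :: "'a::real_inner set \<Rightarrow> nat \<Rightarrow> nat \<Rightarrow> 'a double_form set" where
  "effective_forms B p q = {\<omega> \<in> double_forms p q. contraction B \<omega> = (\<lambda>xs ys. 0)}"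

text \<open>
  The inner product on \<open>D\<^sup>p\<^sup>,\<^sup>q\<close> for which the products of wedges of distinct dual basis elements
  are orthonormal. Every wedge of \<open>p\<close> distinct basis vectors is represented by \<open>p!\<close> lists that
  give the same value up to a sign (and lists with repetitions contribute 0), whence the
  normalisation.
\<close>

definition dform_inner ::
    "'a set \<Rightarrow> nat \<Rightarrow> nat \<Rightarrow> 'a double_form \<Rightarrow> 'a double_form \<Rightarrow> real" where
  "dform_inner B p q \<omega> \<theta> =
     (\<Sum>xs\<in>{xs. set xs \<subseteq> B \<and> length xs = p}. \<Sum>ys\<in>{ys. set ys \<subseteq> B \<and> length ys = q}.
        \<omega> xs ys * \<theta> xs ys) / (fact p * fact q)"

text \<open>\<open>wedge_list bs\<close> is \<open>b\<^sub>1 \<and> \<dots> \<and> b\<^sub>p\<close>. The next lemma confirms the normalisation of \<open>wedge\<close>.\<close>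

definition wedge_list :: "'a::real_inner list \<Rightarrow> 'a form" where
  "wedge_list bs = foldr (\<lambda>b. wedge (covector b)) bs form_one"

lemma wedge_list_same:
  assumes "distinct bs" and "\<forall>a\<in>set bs. \<forall>b\<in>set bs. a \<bullet> b = (if a = b then 1 else 0)"
  shows "wedge_list bs bs = 1"
  using assms
proof (induction bs)
  case Nil
  show ?case by (simp add: wedge_list_def form_one_def)
next
  case (Cons b bs)
  let ?t = "\<lambda>I. shuffle_sign I * covector b (nths (b # bs) I) *
                 wedge_list bs (nths (b # bs) (- I))"
  have "?t I = 0" if I: "I \<in> Pow {..<length (b # bs)} - {{0}}" for I
  proof (cases "length (nths (b # bs) I) = 1")
    case True
    show ?thesis
    proof (cases "0 \<in> I")
      case 0: True
      with True have "nths bs {j. Suc j \<in> I} = []"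
        by (simp add: nths_Cons)
      then have "set (nths bs {j. Suc j \<in> I}) = {}"
        by simp
      then have *: "Suc j \<notin> I" if "j < length bs" for j
        using that by (auto simp: set_nths)
      have "x = 0" if "x \<in> I" for x
        using * that I by (cases x) auto
      then have "I = {0}" using 0 by auto
      then show ?thesis using I by simp
    next
      case False
      then have n: "nths (b # bs) I = nths bs {j. Suc j \<in> I}"
        by (simp add: nths_Cons)
      have "hd (nths (b # bs) I) \<in> set (nths (b # bs) I)"
        using True by (intro hd_in_set) auto
      then have "hd (nths (b # bs) I) \<in> set bs"
        unfolding n using set_nths_subset by fastforce
      then have "b \<bullet> hd (nths (b # bs) I) = 0"
        using Cons.prems by (metis distinct.simps(2) list.set_intros(1,2))
      then show ?thesis by (simp add: covector_def)
    qed
  next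
    case False
    then show ?thesis by (simp add: covector_def)
  qed
  then have "wedge_list (b # bs) (b # bs) = ?t {0}"
    unfolding wedge_list_def foldr.simps o_def wedge_def
    by (subst sum.mono_neutral_right[where S = "{{0}}"]) auto
  also have "\<dots> = 1"
  proof -
    have "{(i, j). i \<in> {0::nat} \<and> j \<notin> {0} \<and> j < i} = {}" by auto
    then have "shuffle_sign {0} = 1"
      unfolding shuffle_sign_def by (metis card.empty power_0)
    moreover have "nths (b # bs) {0} = [b]" "nths (b # bs) (- {0}) = bs"
      by (simp_all add: nths_Cons nths_all)
    ultimately show ?thesis
      using Cons by (simp add: covector_def)
  qed
  finally show ?case .
qed

end

theory Submission
  imports Defs
begin

text \<open>
  Multiplication by \<open>g\<close> and the contraction \<open>c\<close> satisfy \<open>c g - g c = n - p - q\<close> on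
  \<open>D\<^sup>p\<^sup>,\<^sup>q\<close> (because \<open>\<Sum>\<^sub>a e\<^sub>a \<and> (\<iota>\<^sub>a \<alpha>) = p \<alpha>\<close> for \<open>p\<close>-forms), so they generate an action of
  \<open>sl\<^sub>2\<close>, and they are adjoint to each other. For \<open>2k \<le> n\<close> put
  \<open>P\<^sub>k \<eta> = \<Sum>\<^sub>r (-1)\<^sup>r / (r! (n-2k+2) \<dots> (n-2k+1+r)) g\<^sup>r c\<^sup>r \<eta>\<close>. By telescoping sums, \<open>c P\<^sub>k = 0\<close>
  on \<open>D\<^sup>k\<^sup>,\<^sup>k\<close> and \<open>P\<^sub>k g = 0\<close> on \<open>D\<^sup>k\<^sup>-\<^sup>1\<^sup>,\<^sup>k\<^sup>-\<^sup>1\<close>, while \<open>P\<^sub>k\<close> fixes effective forms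
  and \<open>\<eta> - P\<^sub>k \<eta>\<close> is a multiple of \<open>g\<close>. Above the middle degree every form is a multiple of \<open>g\<close>, since
  \<open>c\<^sup>s g\<^sup>s\<close> is a nonzero scalar modulo multiples of \<open>g\<close> and \<open>g\<^sup>s\<close> vanishes for large \<open>s\<close>. Induction on the degree
  gives the decomposition, and applying \<open>P\<^sub>k c\<^sup>p\<^sup>-\<^sup>k\<close> to it isolates a multiple of \<open>\<omega>\<^sub>k\<close>.
\<close>

section \<open>Sums over shuffles\<close>

text \<open>The summand is an arbitrary function of the two complementary sublists, so that a
  shuffle sum can occur inside another one and carry further parameters.\<close>

definition shuffle_sum :: "('a list \<Rightarrow> 'a list \<Rightarrow> real) \<Rightarrow> 'a list \<Rightarrow> real" where
  "shuffle_sum F xs =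
     (\<Sum>I\<in>Pow {..<length xs}. shuffle_sign I * F (nths xs I) (nths xs (- I)))"

lemma wedge_eq_shuffle_sum: "wedge \<alpha> \<beta> = shuffle_sum (\<lambda>us vs. \<alpha> us * \<beta> vs)"
  by (simp add: wedge_def shuffle_sum_def mult.assoc fun_eq_iff)

lemma dform_mult_eq_shuffle_sum:
  "dform_mult \<omega> \<theta> xs ys =
     shuffle_sum (\<lambda>us vs. shuffle_sum (\<lambda>us' vs'. \<omega> us us' * \<theta> vs vs') ys) xs"
  by (simp add: dform_mult_def shuffle_sum_def sum_distrib_left mult.assoc)

lemma shuffle_sum_swap:
  "shuffle_sum (\<lambda>a b. shuffle_sum (\<lambda>c d. F a b c d) ys) xs =
   shuffle_sum (\<lambda>c d. shuffle_sum (\<lambda>a b. F a b c d) xs) ys"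
  unfolding shuffle_sum_def sum_distrib_left
  by (subst sum.swap) (simp add: mult.left_commute)

lemma shuffle_sum_mult_left: "c * shuffle_sum F xs = shuffle_sum (\<lambda>us vs. c * F us vs) xs"
  unfolding shuffle_sum_def sum_distrib_left by (intro sum.cong refl mult.left_commute)

lemma shuffle_sum_mult_right: "shuffle_sum F xs * c = shuffle_sum (\<lambda>us vs. F us vs * c) xs"
  by (simp add: shuffle_sum_def sum_distrib_right mult.assoc)

lemma shuffle_sum_add:
  "shuffle_sum (\<lambda>us vs. F us vs + F' us vs) xs = shuffle_sum F xs + shuffle_sum F' xs"
  by (simp add: shuffle_sum_def distrib_left sum.distrib)

lemma shuffle_sum_sum:
  "shuffle_sum (\<lambda>us vs. \<Sum>k\<in>A. F k us vs) xs = (\<Sum>k\<in>A. shuffle_sum (F k) xs)"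
  unfolding shuffle_sum_def by (simp add: sum_distrib_left) (rule sum.swap)

lemma length_nths_Compl:
  assumes "I \<subseteq> {..<length xs}"
  shows "length (nths xs I) = card I" and "length (nths xs I) + length (nths xs (- I)) = length xs"
proof -
  have *: "{i. i < length xs \<and> i \<in> I} = I" using assms by auto
  show 1: "length (nths xs I) = card I" by (simp add: length_nths *)
  have "{i. i < length xs \<and> i \<in> - I} = {..<length xs} - I" by auto
  then have "length (nths xs (- I)) = card ({..<length xs} - I)" by (simp add: length_nths)
  then show "length (nths xs I) + length (nths xs (- I)) = length xs"
    using assms 1 card_mono[OF _ assms] by (simp add: card_Diff_subset finite_subset)
qed

text \<open>Complementary sublists share out the length of \<open>xs\<close>; this lets a sign
  \<open>(-1) ^ length us\<close> be split over a further shuffle of \<open>us\<close>.\<close>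

lemma shuffle_sum_cong:
  assumes "\<And>us vs. length us + length vs = length xs \<Longrightarrow> F us vs = F' us vs"
  shows "shuffle_sum F xs = shuffle_sum F' xs"
  unfolding shuffle_sum_def
  by (intro sum.cong refl arg_cong2[where f = "(*)"] assms length_nths_Compl) auto

text \<open>Position 0, when it goes to the first factor, has nothing below it to be moved past, so
  the inversions are those of \<open>I\<close> shifted by one.\<close>

lemma shuffle_sign_insert_0:
  assumes "finite I"
  shows "shuffle_sign (insert 0 (Suc ` I)) = shuffle_sign I"
proof -
  have "{(i, j). i \<in> insert 0 (Suc ` I) \<and> j \<notin> insert 0 (Suc ` I) \<and> j < i} =
        map_prod Suc Suc ` {(i, j). i \<in> I \<and> j \<notin> I \<and> j < i}" (is "?L = ?R")
  proof
    show "?L \<subseteq> ?R"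
    proof
      fix z assume "z \<in> ?L"
      then obtain i j where z: "z = (i, j)" "i \<in> insert 0 (Suc ` I)"
        "j \<notin> insert 0 (Suc ` I)" "j < i" by auto
      then show "z \<in> ?R" by (cases i; cases j) (force simp: image_iff)+
    qed
  qed auto
  moreover have "inj_on (map_prod Suc Suc) X" for X by (auto simp: inj_on_def)
  ultimately show ?thesis unfolding shuffle_sign_def by (simp add: card_image)
qed

text \<open>Position 0 now lies outside the set and below all its elements, which adds one inversion
  for each element of \<open>I\<close>.\<close>

lemma shuffle_sign_Suc_image:
  assumes "finite I"
  shows "shuffle_sign (Suc ` I) = (-1) ^ card I * shuffle_sign I"
proof -
  let ?S = "{(i, j). i \<in> I \<and> j \<notin> I \<and> j < i}"
  have fin: "finite ?S"
    by (rule finite_subset[of _ "Sigma I (\<lambda>i. {..<i})"]) (use assms in auto)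
  have "{(i, j). i \<in> Suc ` I \<and> j \<notin> Suc ` I \<and> j < i} =
        (\<lambda>i. (Suc i, 0)) ` I \<union> map_prod Suc Suc ` ?S" (is "?L = ?R")
  proof
    show "?L \<subseteq> ?R"
    proof
      fix z assume "z \<in> ?L"
      then obtain i j where z: "z = (Suc i, j)" "i \<in> I" "j \<notin> Suc ` I" "j < Suc i" by auto
      then show "z \<in> ?R" by (cases j) (force simp: image_iff)+
    qed
  qed auto
  moreover have "inj_on (map_prod Suc Suc) X" for X by (auto simp: inj_on_def)
  moreover have "inj_on (\<lambda>i. (Suc i, 0::nat)) I" by (auto simp: inj_on_def)
  moreover have "(\<lambda>i. (Suc i, 0)) ` I \<inter> map_prod Suc Suc ` ?S = {}" by auto
  ultimately show ?thesis unfolding shuffle_sign_def using fin assms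
    by (simp add: card_image card_Un_disjoint power_add)
qed

lemma sum_Pow_Suc:
  fixes f :: "nat set \<Rightarrow> real"
  shows "(\<Sum>I\<in>Pow {..<Suc n}. f I) =
     (\<Sum>I\<in>Pow {..<n}. f (insert 0 (Suc ` I))) + (\<Sum>I\<in>Pow {..<n}. f (Suc ` I))"
proof -
  have inj: "inj_on ((`) Suc) X" for X by (auto simp: inj_on_def inj_image_eq_iff)
  have P: "Pow (Suc ` {..<n}) = (`) Suc ` Pow {..<n}"
    by (simp add: image_Pow_surj)
  have "Pow {..<Suc n} = insert 0 ` Pow (Suc ` {..<n}) \<union> Pow (Suc ` {..<n})"
    by (simp add: lessThan_Suc_eq_insert_0 Pow_insert Un_commute)
  moreover have "insert 0 ` Pow (Suc ` {..<n}) \<inter> Pow (Suc ` {..<n}) = {}" by auto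
  ultimately have "(\<Sum>I\<in>Pow {..<Suc n}. f I) =
      (\<Sum>I\<in>insert 0 ` Pow (Suc ` {..<n}). f I) + (\<Sum>I\<in>Pow (Suc ` {..<n}). f I)"
    by (simp add: sum.union_disjoint)
  moreover have "inj_on (insert 0) (Pow (Suc ` {..<n}))"
    by (intro inj_onI) (metis PowD insert_ident imageE in_mono nat.distinct(1))
  ultimately show ?thesis
    by (simp add: sum.reindex P inj)
qed

lemma nths_Cons_image:
  "nths (x # xs) (insert 0 (Suc ` I)) = x # nths xs I"
  "nths (x # xs) (Suc ` I) = nths xs I"
  "nths (x # xs) (- insert 0 (Suc ` I)) = nths xs (- I)"
  "nths (x # xs) (- (Suc ` I)) = x # nths xs (- I)"
proof -
  have "{j. Suc j \<in> insert 0 (Suc ` I)} = I" "{j. Suc j \<in> Suc ` I} = I"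
    "{j. Suc j \<in> - insert 0 (Suc ` I)} = - I" "{j. Suc j \<in> - (Suc ` I)} = - I" by auto
  then show "nths (x # xs) (insert 0 (Suc ` I)) = x # nths xs I"
    "nths (x # xs) (Suc ` I) = nths xs I"
    "nths (x # xs) (- insert 0 (Suc ` I)) = nths xs (- I)"
    "nths (x # xs) (- (Suc ` I)) = x # nths xs (- I)"
    by (auto simp: nths_Cons)
qed

lemma shuffle_sum_Nil: "shuffle_sum F [] = F [] []"
  by (simp add: shuffle_sum_def shuffle_sign_def)

text \<open>The head goes either to the first factor, or to the second one past the
  \<open>length us\<close> entries of the first. This recursion allows inductions on lists in place
  of permutations of positions.\<close>

lemma shuffle_sum_Cons:
  "shuffle_sum F (x # xs) = shuffle_sum (\<lambda>us vs. F (x # us) vs) xs +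
     shuffle_sum (\<lambda>us vs. (-1) ^ length us * F us (x # vs)) xs"
proof -
  have fin: "finite I" if "I \<in> Pow {..<length xs}" for I using that finite_subset by auto
  have "shuffle_sum F (x # xs) =
    (\<Sum>I\<in>Pow {..<length xs}. shuffle_sign I * F (x # nths xs I) (nths xs (- I))) +
    (\<Sum>I\<in>Pow {..<length xs}. (-1) ^ card I * shuffle_sign I * F (nths xs I) (x # nths xs (- I)))"
    unfolding shuffle_sum_def list.size add_Suc_right add_0_right sum_Pow_Suc nths_Cons_image
    using fin by (intro arg_cong2[where f = "(+)"] sum.cong refl)
      (simp_all add: shuffle_sign_insert_0 shuffle_sign_Suc_image)
  then show ?thesis
    by (simp add: shuffle_sum_def length_nths_Compl mult_ac)
qed

text \<open>Both sides distribute the entries over three lists. The head has three destinations,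
  each with the same sign on both sides; \<open>F\<close> varies because the head is absorbed into
  it.\<close>

lemma shuffle_sum_assoc:
  "shuffle_sum (\<lambda>us vs. shuffle_sum (\<lambda>ps qs. F ps qs vs) us) xs =
   shuffle_sum (\<lambda>us vs. shuffle_sum (\<lambda>ps qs. F us ps qs) vs) xs"
proof (induction xs arbitrary: F)
  case Nil
  show ?case by (simp add: shuffle_sum_Nil)
next
  case (Cons x xs)
  \<comment> \<open>A head that goes to the third list passes the first two, whose lengths add up to
    \<open>length us\<close>.\<close>
  have "shuffle_sum (\<lambda>us vs. (-1) ^ length us * shuffle_sum (\<lambda>ps qs. F ps qs (x # vs)) us) xs =
     shuffle_sum (\<lambda>us vs. shuffle_sum (\<lambda>ps qs. (-1) ^ length ps * ((-1) ^ length qs * F ps qs (x # vs))) us) xs"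
    unfolding shuffle_sum_mult_left
    by (intro shuffle_sum_cong) (simp flip: power_add mult.assoc)
  then show ?case
    by (simp add: shuffle_sum_Cons shuffle_sum_add Cons.IH shuffle_sum_mult_left distrib_left add.assoc)
qed

lemma dform_mult_assoc:
  "dform_mult (dform_mult \<omega> \<theta>) \<psi> = dform_mult \<omega> (dform_mult \<theta> \<psi>)"
proof (intro ext)
  fix xs ys
  have "dform_mult (dform_mult \<omega> \<theta>) \<psi> xs ys =
    shuffle_sum (\<lambda>us vs. shuffle_sum (\<lambda>ps qs. shuffle_sum (\<lambda>us' vs'.
      shuffle_sum (\<lambda>ps' qs'. \<omega> ps ps' * \<theta> qs qs' * \<psi> vs vs') us') ys) us) xs"
    unfolding dform_mult_eq_shuffle_sum shuffle_sum_mult_right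
    by (subst shuffle_sum_swap) (rule refl)
  \<comment> \<open>Associativity of shuffle sums is used once for the sublists of \<open>xs\<close>
    and once for those of \<open>ys\<close>.\<close>
  also have "\<dots> = shuffle_sum (\<lambda>us vs. shuffle_sum (\<lambda>ps qs. shuffle_sum (\<lambda>us' vs'.
      shuffle_sum (\<lambda>ps' qs'. \<omega> us us' * \<theta> ps ps' * \<psi> qs qs') vs') ys) vs) xs"
    by (subst shuffle_sum_assoc, subst shuffle_sum_assoc) (rule refl)
  also have "\<dots> = dform_mult \<omega> (dform_mult \<theta> \<psi>) xs ys"
    unfolding dform_mult_eq_shuffle_sum shuffle_sum_mult_left mult.assoc
    by (subst shuffle_sum_swap) (rule refl)
  finally show "dform_mult (dform_mult \<omega> \<theta>) \<psi> xs ys = dform_mult \<omega> (dform_mult \<theta> \<psi>) xs ys" .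
qed

section \<open>Alternating forms\<close>

lemma wedge_form_one [simp]: "wedge form_one \<alpha> = \<alpha>"
proof
  fix xs show "wedge form_one \<alpha> xs = \<alpha> xs"
  proof (induction xs arbitrary: \<alpha>)
    case Nil
    show ?case by (simp add: wedge_eq_shuffle_sum shuffle_sum_Nil form_one_def)
  next
    case (Cons x xs)
    have "wedge form_one \<alpha> (x # xs) =
        shuffle_sum (\<lambda>us vs. 0) xs + wedge form_one (\<lambda>vs. \<alpha> (x # vs)) xs"
      unfolding wedge_eq_shuffle_sum shuffle_sum_Cons
      by (intro arg_cong2[where f = "(+)"] shuffle_sum_cong) (auto simp: form_one_def)
    then show ?case by (simp add: Cons.IH shuffle_sum_def)
  qed
qed

lemma wedge_covector_Nil [simp]: "wedge (covector b) \<alpha> [] = 0"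
  by (simp add: wedge_eq_shuffle_sum shuffle_sum_Nil covector_def)

text \<open>The Leibniz rule for the antiderivation that inserts \<open>x\<close> into the first
  slot; the later computations with the metric rest on it.\<close>

lemma wedge_covector_Cons [simp]:
  "wedge (covector b) \<alpha> (x # xs) = (b \<bullet> x) * \<alpha> xs - wedge (covector b) (\<lambda>zs. \<alpha> (x # zs)) xs"
proof -
  \<comment> \<open>A first factor that holds \<open>x\<close> must be otherwise empty, which
    \<open>form_one\<close> records; in the second sum \<open>covector b\<close> forces
    \<open>length us = 1\<close>, whence the sign -1.\<close>
  have "wedge (covector b) \<alpha> (x # xs) =
      shuffle_sum (\<lambda>us vs. (b \<bullet> x) * (form_one us * \<alpha> vs)) xs +
      shuffle_sum (\<lambda>us vs. (- 1) * (covector b us * \<alpha> (x # vs))) xs"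
    unfolding wedge_eq_shuffle_sum shuffle_sum_Cons
    by (intro arg_cong2[where f = "(+)"] shuffle_sum_cong) (auto simp: form_one_def covector_def)
  then show ?thesis
    unfolding shuffle_sum_mult_left[symmetric] wedge_eq_shuffle_sum[symmetric, THEN fun_cong]
    by simp
qed

lemma wedge_lincomb_right:
  "wedge \<alpha> (\<lambda>xs. a * \<beta> xs + b * \<gamma> xs) xs = a * wedge \<alpha> \<beta> xs + b * wedge \<alpha> \<gamma> xs"
  by (simp add: wedge_eq_shuffle_sum distrib_left mult.left_commute shuffle_sum_add
      flip: shuffle_sum_mult_left)

lemma wedge_zero_right [simp]: "wedge \<alpha> (\<lambda>xs. 0) xs = 0"
  by (simp add: wedge_def)

lemma wedge_sum_right: "wedge \<alpha> (\<lambda>xs. \<Sum>k\<in>A. \<beta> k xs) xs = (\<Sum>k\<in>A. wedge \<alpha> (\<beta> k) xs)"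
  by (simp add: wedge_eq_shuffle_sum sum_distrib_left shuffle_sum_sum)

section \<open>Closure properties of alternating forms\<close>

lemma alt_forms_linear:
  "\<alpha> \<in> alt_forms p \<Longrightarrow> length xs = p \<Longrightarrow> i < p \<Longrightarrow> linear (\<lambda>x. \<alpha> (xs[i := x]))"
  by (simp add: alt_forms_def)

lemma alt_forms_not_distinct: "\<alpha> \<in> alt_forms p \<Longrightarrow> \<not> distinct xs \<Longrightarrow> \<alpha> xs = 0"
  by (simp add: alt_forms_def)

lemma alt_forms_length: "\<alpha> \<in> alt_forms p \<Longrightarrow> length xs \<noteq> p \<Longrightarrow> \<alpha> xs = 0"
  by (simp add: alt_forms_def)

lemma alt_forms_zero: "(\<lambda>xs. 0) \<in> alt_forms p"
  by (simp add: alt_forms_def linear_zero)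

lemma linear_lincomb:
  fixes f g :: "'a::real_vector \<Rightarrow> real"
  shows "linear f \<Longrightarrow> linear g \<Longrightarrow> linear (\<lambda>x. a * f x + b * g x)"
  by (auto simp: linear_iff algebra_simps)

lemma alt_forms_lincomb:
  assumes "\<alpha> \<in> alt_forms p" "\<beta> \<in> alt_forms p"
  shows "(\<lambda>xs. a * \<alpha> xs + b * \<beta> xs) \<in> alt_forms p"
  using assms by (auto simp: alt_forms_def intro: linear_lincomb)

text \<open>For \<open>p = 0\<close> the truncated degree \<open>p - 1\<close> is harmless: the form
  vanishes on nonempty lists, and the zero form lies in \<open>alt_forms 0\<close>.\<close>

lemma alt_forms_Cons:
  assumes "\<alpha> \<in> alt_forms p"
  shows "(\<lambda>xs. \<alpha> (x # xs)) \<in> alt_forms (p - 1)"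
proof (cases p)
  case 0
  then have "(\<lambda>xs. \<alpha> (x # xs)) = (\<lambda>xs. 0)" using assms by (auto simp: alt_forms_def)
  then show ?thesis by (simp add: alt_forms_zero)
next
  case (Suc q)
  have "linear (\<lambda>z. \<alpha> (x # xs[i := z]))" if "length xs = q" "i < q" for xs i
    using alt_forms_linear[OF assms, of "x # xs" "Suc i"] that Suc by simp
  moreover have "\<alpha> (x # xs) = 0" if "length xs \<noteq> q" for xs
    using alt_forms_length[OF assms, of "x # xs"] that Suc by simp
  moreover have "\<alpha> (x # xs) = 0" if "\<not> distinct xs" for xs
    using alt_forms_not_distinct[OF assms, of "x # xs"] that by simp
  ultimately show ?thesis using Suc by (simp add: alt_forms_def)
qed

lemma linear_alt_forms_Cons:
  assumes "\<alpha> \<in> alt_forms p"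
  shows "linear (\<lambda>x. \<alpha> (x # xs))"
proof (cases "p = Suc (length xs)")
  case True
  then show ?thesis using alt_forms_linear[OF assms, of "0 # xs" 0] by simp
next
  case False
  then have "(\<lambda>x. \<alpha> (x # xs)) = (\<lambda>x. 0)" using assms by (auto simp: alt_forms_def)
  then show ?thesis by (simp add: linear_zero)
qed

text \<open>Polarisation of \<open>f (x + y) (x + y) = 0\<close>.\<close>

lemma alternating_swap:
  fixes f :: "'a::real_vector \<Rightarrow> 'a \<Rightarrow> real"
  assumes "\<And>y. linear (\<lambda>x. f x y)" "\<And>x. linear (f x)" "\<And>x. f x x = 0"
  shows "f x y = - f y x"
proof -
  have "f (x + y) (x + y) = f x x + f x y + f y x + f y y"
    using assms(1,2) by (simp add: linear_add[OF assms(1)] linear_add[OF assms(2)])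
  then show ?thesis using assms(3) by simp
qed

lemma alt_forms_swap:
  assumes "\<alpha> \<in> alt_forms p"
  shows "\<alpha> (x # y # xs) = - \<alpha> (y # x # xs)"
proof (rule alternating_swap[of "\<lambda>x y. \<alpha> (x # y # xs)"])
  show "linear (\<lambda>y. \<alpha> (x # y # xs))" for x
    using linear_alt_forms_Cons[OF alt_forms_Cons[OF assms]] .
qed (use assms in \<open>auto intro: linear_alt_forms_Cons alt_forms_not_distinct\<close>)

text \<open>A criterion suited to the recursion \<open>wedge_covector_Cons\<close>: besides the
  tails, repetitions are tested only in the first two slots.\<close>

lemma alt_forms_SucI:
  assumes nil: "\<alpha> [] = 0"
    and alt: "\<And>x. (\<lambda>xs. \<alpha> (x # xs)) \<in> alt_forms p"
    and lin: "\<And>xs. linear (\<lambda>x. \<alpha> (x # xs))"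
    and dup: "\<And>x xs. \<alpha> (x # x # xs) = 0"
  shows "\<alpha> \<in> alt_forms (Suc p)"
proof -
  have "\<alpha> xs = 0" if "length xs \<noteq> Suc p" for xs
    using that nil alt_forms_length[OF alt] by (cases xs) auto
  moreover have "linear (\<lambda>x. \<alpha> (xs[i := x]))" if "length xs = Suc p" "i < Suc p" for xs i
  proof (cases i)
    case 0
    with that show ?thesis by (cases xs) (auto simp: lin)
  next
    case (Suc j)
    with that obtain y ys where "xs = y # ys" "length ys = p" "j < p" by (cases xs) auto
    with Suc show ?thesis using alt[of y] by (simp add: alt_forms_def)
  qed
  moreover have "\<alpha> xs = 0" if "\<not> distinct xs" for xs
  proof (cases xs)
    case Nil
    with that show ?thesis by simp
  next
    case (Cons x ys)
    show ?thesis
    proof (cases "distinct ys")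
      case False
      then show ?thesis using alt_forms_not_distinct[OF alt] Cons by simp
    next
      case True
      with that Cons have x: "x \<in> set ys" by simp
      then obtain y zs where ys: "ys = y # zs" by (cases ys) auto
      \<comment> \<open>Unless \<open>x = y\<close>, the exchange moves the repeated
        \<open>x\<close> into the tail \<open>x # zs\<close>, where \<open>alt\<close>
        applies.\<close>
      have "\<alpha> (x # y # zs) = - \<alpha> (y # x # zs)"
        by (rule alternating_swap[of "\<lambda>x y. \<alpha> (x # y # zs)"])
          (auto simp: lin dup linear_alt_forms_Cons[OF alt])
      moreover have "\<alpha> (y # x # zs) = 0" if "x \<noteq> y"
        using x ys that by (intro alt_forms_not_distinct[OF alt]) auto
      ultimately show ?thesis using ys Cons dup by (cases "x = y") auto
    qed
  qed
  ultimately show ?thesis by (simp add: alt_forms_def)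
qed

text \<open>On \<open>x # x # xs\<close> the Leibniz rule, applied twice, gives two equal terms of
  opposite sign and a wedge with a form into which \<open>x\<close> is inserted twice, which is
  0.\<close>

lemma wedge_covector_alt_forms:
  assumes "\<alpha> \<in> alt_forms p"
  shows "wedge (covector b) \<alpha> \<in> alt_forms (Suc p)"
  using assms
proof (induction p arbitrary: \<alpha>)
  case 0
  then have [simp]: "\<alpha> (x # xs) = 0" for x xs by (simp add: alt_forms_def)
  show ?case
    using alt_forms_lincomb[OF 0 alt_forms_zero] 
    by (intro alt_forms_SucI) (auto simp: inner_add_right linear_iff distrib_right)
next
  case (Suc p)
  have *: "wedge (covector b) (\<lambda>zs. \<alpha> (x # zs)) \<in> alt_forms (Suc p)" for x
    using Suc.IH[OF alt_forms_Cons[OF Suc.prems, simplified]] .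
  have lin: "linear (\<lambda>x. wedge (covector b) (\<lambda>zs. \<alpha> (x # zs)) xs)" for xs
    unfolding linear_iff
    using wedge_lincomb_right[of "covector b" 1 _ 1 _ xs] wedge_lincomb_right[of "covector b" _ _ 0 _ xs]
    by (simp add: linear_add[OF linear_alt_forms_Cons[OF Suc.prems]]
          linear_scale[OF linear_alt_forms_Cons[OF Suc.prems]])
  show ?case
  proof (rule alt_forms_SucI)
    show "(\<lambda>xs. wedge (covector b) \<alpha> (x # xs)) \<in> alt_forms (Suc p)" for x
      using alt_forms_lincomb[OF Suc.prems *, of "b \<bullet> x" "- 1"] by simp
    show "linear (\<lambda>x. wedge (covector b) \<alpha> (x # xs))" for xs
      using linear_lincomb[OF _ lin, of "(\<bullet>) b" "\<alpha> xs" "- 1"]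
      by (simp add: bounded_linear.linear bounded_linear_inner_right mult.commute)
  qed (use alt_forms_not_distinct[OF Suc.prems] in auto)
qed

section \<open>Double forms\<close>

lemma alt_forms_scale: "\<alpha> \<in> alt_forms p \<Longrightarrow> (\<lambda>xs. a * \<alpha> xs) \<in> alt_forms p"
  using alt_forms_lincomb[of \<alpha> p \<alpha> a 0] by simp

lemma alt_forms_sum:
  assumes "\<And>k. k \<in> A \<Longrightarrow> \<alpha> k \<in> alt_forms p"
  shows "(\<lambda>xs. \<Sum>k\<in>A. \<alpha> k xs) \<in> alt_forms p"
  using assms
proof (induction A rule: infinite_finite_induct)
  case (insert k A)
  then show ?case using alt_forms_lincomb[of "\<alpha> k" p "\<lambda>xs. \<Sum>k\<in>A. \<alpha> k xs" 1 1] by simp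
qed (simp_all add: alt_forms_zero)

lemma double_formsI:
  "(\<And>ys. (\<lambda>xs. \<omega> xs ys) \<in> alt_forms p) \<Longrightarrow> (\<And>xs. \<omega> xs \<in> alt_forms q) \<Longrightarrow> \<omega> \<in> double_forms p q"
  by (simp add: double_forms_def)

lemma double_formsD:
  assumes "\<omega> \<in> double_forms p q"
  shows "(\<lambda>xs. \<omega> xs ys) \<in> alt_forms p" and "\<omega> xs \<in> alt_forms q"
  using assms by (simp_all add: double_forms_def)

lemma double_forms_zero: "(\<lambda>xs ys. 0) \<in> double_forms p q"
  by (intro double_formsI alt_forms_zero)

lemma double_forms_lincomb:
  assumes "\<omega> \<in> double_forms p q" "\<theta> \<in> double_forms p q"
  shows "(\<lambda>xs ys. a * \<omega> xs ys + b * \<theta> xs ys) \<in> double_forms p q"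
  by (intro double_formsI alt_forms_lincomb double_formsD[OF assms(1)] double_formsD[OF assms(2)])

lemma double_forms_sum:
  assumes "\<And>k. k \<in> A \<Longrightarrow> \<omega> k \<in> double_forms p q"
  shows "(\<lambda>xs ys. \<Sum>k\<in>A. \<omega> k xs ys) \<in> double_forms p q"
  by (intro double_formsI alt_forms_sum double_formsD[OF assms])

lemma double_forms_scale:
  "\<omega> \<in> double_forms p q \<Longrightarrow> (\<lambda>xs ys. a * \<omega> xs ys) \<in> double_forms p q"
  using double_forms_lincomb[of \<omega> p q \<omega> a 0] by simp

text \<open>Linearity over all functions of two lists, so that its use needs no membership in a
  space of double forms.\<close>

definition dform_linear :: "('a double_form \<Rightarrow> 'a double_form) \<Rightarrow> bool" where
  "dform_linear T \<longleftrightarrow> (\<forall>a b \<omega> \<theta>. T (\<lambda>xs ys. a * \<omega> xs ys + b * \<theta> xs ys) =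
     (\<lambda>xs ys. a * T \<omega> xs ys + b * T \<theta> xs ys))"

lemma dform_linear_lincomb:
  "dform_linear T \<Longrightarrow> T (\<lambda>xs ys. a * \<omega> xs ys + b * \<theta> xs ys) =
     (\<lambda>xs ys. a * T \<omega> xs ys + b * T \<theta> xs ys)"
  by (simp add: dform_linear_def)

lemma dform_linear_scale: "dform_linear T \<Longrightarrow> T (\<lambda>xs ys. a * \<omega> xs ys) = (\<lambda>xs ys. a * T \<omega> xs ys)"
  using dform_linear_lincomb[of T a \<omega> 0 \<omega>] by simp

lemma dform_linear_zero: "dform_linear T \<Longrightarrow> T (\<lambda>xs ys. 0) = (\<lambda>xs ys. 0)"
  using dform_linear_scale[of T 0] by simp

lemma dform_linear_sum:
  assumes "dform_linear T"
  shows "T (\<lambda>xs ys. \<Sum>k\<in>A. a k * \<omega> k xs ys) = (\<lambda>xs ys. \<Sum>k\<in>A. a k * T (\<omega> k) xs ys)"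
proof (induction A rule: infinite_finite_induct)
  case (insert k A)
  then show ?case
    using dform_linear_lincomb[OF assms, of "a k" "\<omega> k" 1 "\<lambda>xs ys. \<Sum>k\<in>A. a k * \<omega> k xs ys"]
    by simp
qed (simp_all add: dform_linear_zero[OF assms])

lemma dform_linear_funpow: "dform_linear T \<Longrightarrow> dform_linear (T ^^ m)"
  by (induction m) (simp_all add: dform_linear_def)

lemma dform_linear_dform_mult: "dform_linear (dform_mult \<omega>)"
  by (simp add: dform_linear_def dform_mult_def fun_eq_iff sum.distrib sum_distrib_left
      distrib_left mult.left_commute)

lemma dform_linear_contraction: "dform_linear (contraction B)"
  by (simp add: dform_linear_def contraction_def fun_eq_iff sum.distrib sum_distrib_left)

lemma dform_mult_one [simp]: "dform_mult dform_one \<omega> = \<omega>"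
proof (intro ext)
  fix xs ys
  have "dform_mult dform_one \<omega> xs ys = wedge form_one (\<lambda>us. wedge form_one (\<omega> us) ys) xs"
    by (simp only: dform_mult_eq_shuffle_sum wedge_eq_shuffle_sum dform_one_def tensor_def
        shuffle_sum_mult_left mult.assoc)
  then show "dform_mult dform_one \<omega> xs ys = \<omega> xs ys" by simp
qed

section \<open>Multiplication by the metric, contraction and their effect on degrees\<close>

lemma dform_mult_metric_power:
  "dform_mult (metric_power B r) \<omega> = (dform_mult (metric B) ^^ r) \<omega>"
  by (induction r) (simp_all add: metric_power_def dform_mult_assoc)

text \<open>The metric is a sum of pure tensors, so it acts by a covector wedge in each argument
  separately, and the Leibniz rule applies to both.\<close>

lemma dform_mult_metric_eq:
  "dform_mult (metric B) \<omega> xs ys =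
     (\<Sum>b\<in>B. wedge (covector b) (\<lambda>us. wedge (covector b) (\<omega> us) ys) xs)"
  by (simp only: dform_mult_eq_shuffle_sum wedge_eq_shuffle_sum metric_def tensor_def
      shuffle_sum_mult_left mult.assoc sum_distrib_right shuffle_sum_sum)

lemma wedge_alt_forms_parameter:
  assumes "\<And>ys. (\<lambda>xs. \<omega> xs ys) \<in> alt_forms p"
  shows "(\<lambda>xs. wedge \<alpha> (\<omega> xs) ys) \<in> alt_forms p"
  unfolding wedge_def by (intro alt_forms_sum alt_forms_scale assms)

lemma dform_mult_metric_double_forms:
  assumes "\<omega> \<in> double_forms p q"
  shows "dform_mult (metric B) \<omega> \<in> double_forms (Suc p) (Suc q)"
proof (rule double_formsI)
  show "(\<lambda>xs. dform_mult (metric B) \<omega> xs ys) \<in> alt_forms (Suc p)" for ys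
    unfolding dform_mult_metric_eq
    by (intro alt_forms_sum wedge_covector_alt_forms wedge_alt_forms_parameter double_formsD[OF assms])
  have "dform_mult (metric B) \<omega> xs = (\<lambda>ys. \<Sum>b\<in>B. wedge (covector b) (\<lambda>us. wedge (covector b) (\<omega> us) ys) xs)" for xs
    by (rule ext) (rule dform_mult_metric_eq)
  then show "dform_mult (metric B) \<omega> xs \<in> alt_forms (Suc q)" for xs
    by simp (intro alt_forms_sum wedge_alt_forms_parameter wedge_covector_alt_forms double_formsD[OF assms])
qed

lemma funpow_dform_mult_metric_double_forms:
  "\<omega> \<in> double_forms p q \<Longrightarrow> (dform_mult (metric B) ^^ r) \<omega> \<in> double_forms (p + r) (q + r)"
  by (induction r) (simp_all add: dform_mult_metric_double_forms)

lemma contraction_double_forms: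
  assumes "\<omega> \<in> double_forms p q"
  shows "contraction B \<omega> \<in> double_forms (p - 1) (q - 1)"
  unfolding contraction_def
  by (intro double_forms_sum double_formsI alt_forms_Cons double_formsD[OF assms]
     alt_forms_Cons[of "\<lambda>xs. \<omega> xs (_ # _)"])

lemma funpow_contraction_double_forms:
  "\<omega> \<in> double_forms p q \<Longrightarrow> (contraction B ^^ r) \<omega> \<in> double_forms (p - r) (q - r)"
proof (induction r)
  case (Suc r)
  then show ?case using contraction_double_forms[of "(contraction B ^^ r) \<omega>" "p - r" "q - r"] by simp
qed simp

lemma contraction_double_forms_0:
  assumes "\<omega> \<in> double_forms 0 q"
  shows "contraction B \<omega> = (\<lambda>xs ys. 0)"
  using alt_forms_length[OF double_formsD(1)[OF assms]] by (simp add: contraction_def)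

lemma funpow_contraction_eq_0:
  assumes "\<omega> \<in> double_forms p p" "p < r"
  shows "(contraction B ^^ r) \<omega> = (\<lambda>xs ys. 0)"
proof -
  have "(contraction B ^^ Suc p) \<omega> = (\<lambda>xs ys. 0)"
    using funpow_contraction_double_forms[OF assms(1), where r = p and B = B]
    by (simp add: contraction_double_forms_0)
  moreover obtain s where "r = s + Suc p" using assms(2) by (metis add.commute less_iff_Suc_add add_Suc_right)
  ultimately show ?thesis
    by (simp only: funpow_add o_apply dform_linear_zero dform_linear_funpow dform_linear_contraction)
qed

section \<open>The contraction and multiplication by the metric\<close>

abbreviation basis_lists :: "'a set \<Rightarrow> nat \<Rightarrow> 'a list set" where
  "basis_lists B p \<equiv> {xs. set xs \<subseteq> B \<and> length xs = p}"

locale euclidean_basis =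
  fixes B :: "'a::real_inner set"
  assumes basis: "orthonormal_basis B"
begin

lemma finite_B [simp]: "finite B"
  using basis by (simp add: orthonormal_basis_def)

lemma inner_B: "a \<in> B \<Longrightarrow> b \<in> B \<Longrightarrow> a \<bullet> b = (if a = b then 1 else 0)"
  using basis by (simp add: orthonormal_basis_def)

lemma card_B: "card B = dim (UNIV :: 'a set)"
proof -
  have "pairwise orthogonal B" using inner_B by (simp add: pairwise_def orthogonal_def)
  moreover have "0 \<notin> B" using inner_B[of 0 0] by auto
  ultimately have "independent B" by (rule pairwise_orthogonal_independent)
  then show ?thesis using basis
    by (metis dim_span dim_eq_card_independent orthonormal_basis_def)
qed

lemma basis_expand:
  fixes f :: "'a \<Rightarrow> real"
  assumes "linear f"
  shows "(\<Sum>b\<in>B. (b \<bullet> x) * f b) = f x"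
proof -
  have "pairwise orthogonal B" using inner_B by (simp add: pairwise_def orthogonal_def)
  moreover have "norm b = 1" if "b \<in> B" for b using inner_B[OF that that] by (simp add: norm_eq_sqrt_inner)
  moreover have "x \<in> span B" using basis by (simp add: orthonormal_basis_def)
  ultimately have "x = (\<Sum>b\<in>B. (x \<bullet> b) *\<^sub>R b)" by (simp add: orthonormal_basis_expand)
  then have "f x = f (\<Sum>b\<in>B. (x \<bullet> b) *\<^sub>R b)" by simp
  also have "\<dots> = (\<Sum>b\<in>B. (x \<bullet> b) * f b)"
    by (simp add: linear_sum[OF assms] linear_scale[OF assms])
  finally have "f x = (\<Sum>b\<in>B. (x \<bullet> b) * f b)" .
  then show ?thesis by (simp add: inner_commute)
qed

lemma sum_delta_B:
  fixes f :: "'a \<Rightarrow> real"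
  assumes "a \<in> B"
  shows "(\<Sum>b\<in>B. (b \<bullet> a) * f b) = f a" and "(\<Sum>b\<in>B. (a \<bullet> b) * f b) = f a"
proof -
  have "(\<Sum>b\<in>B. (b \<bullet> a) * f b) = (\<Sum>b\<in>B. if b = a then f b else 0)"
    by (intro sum.cong) (simp_all add: inner_B assms)
  also have "\<dots> = f a" using assms by (simp add: sum.delta)
  finally show "(\<Sum>b\<in>B. (b \<bullet> a) * f b) = f a" .
  then show "(\<Sum>b\<in>B. (a \<bullet> b) * f b) = f a" by (simp add: inner_commute)
qed

text \<open>The Leibniz rule leaves one copy of \<open>\<alpha>\<close>, by expansion of
  \<open>x\<close> in the basis, and a sum of the same kind for the form of degree
  \<open>p - 1\<close> obtained by inserting \<open>x\<close>.\<close>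

lemma sum_wedge_covector_Cons:
  assumes "\<alpha> \<in> alt_forms p"
  shows "(\<Sum>a\<in>B. wedge (covector a) (\<lambda>us. \<alpha> (a # us)) xs) = real p * \<alpha> xs"
  using assms
proof (induction xs arbitrary: \<alpha> p)
  case Nil
  then show ?case using alt_forms_length[OF Nil, of "[]"] by auto
next
  case (Cons x xs)
  have "(\<Sum>a\<in>B. wedge (covector a) (\<lambda>us. \<alpha> (a # us)) (x # xs)) =
      \<alpha> (x # xs) - (\<Sum>a\<in>B. wedge (covector a) (\<lambda>us. \<alpha> (a # x # us)) xs)"
    by (simp add: sum_subtractf basis_expand linear_alt_forms_Cons[OF Cons.prems])
  \<comment> \<open>The swap brings \<open>x\<close> to the front and supplies the sign with which
    the counts add up as \<open>1 + (p - 1)\<close>.\<close>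
  also have "(\<Sum>a\<in>B. wedge (covector a) (\<lambda>us. \<alpha> (a # x # us)) xs) =
      - (\<Sum>a\<in>B. wedge (covector a) (\<lambda>us. \<alpha> (x # a # us)) xs)"
    unfolding sum_negf[symmetric]
    using wedge_lincomb_right[of _ "-1" _ 0 _ xs] alt_forms_swap[OF Cons.prems, of _ x]
    by (intro sum.cong refl) simp
  also have "\<dots> = - (real (p - 1) * \<alpha> (x # xs))"
    using Cons.IH[OF alt_forms_Cons[OF Cons.prems]] by simp
  finally show ?case
    using alt_forms_length[OF Cons.prems, of "x # xs"] by (cases p) (simp_all add: algebra_simps)
qed

text \<open>The Leibniz rule in both arguments gives four sums: the squared inner products yield
  \<open>card B\<close>, the two mixed sums are evaluated by \<open>sum_wedge_covector_Cons\<close>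
  and yield \<open>- p\<close> and \<open>- q\<close>, and the last is the metric times the
  contraction.\<close>

lemma contraction_dform_mult_metric:
  assumes "\<omega> \<in> double_forms p q"
  shows "contraction B (dform_mult (metric B) \<omega>) =
    (\<lambda>xs ys. dform_mult (metric B) (contraction B \<omega>) xs ys +
       (real (card B) - real p - real q) * \<omega> xs ys)"
proof (intro ext)
  fix xs ys
  let ?W = "\<lambda>b. wedge (covector b)"
  have term_eq: "?W b (\<lambda>us. ?W b (\<omega> us) (a # ys)) (a # xs) =
      (b \<bullet> a) * ((b \<bullet> a) * \<omega> xs ys - ?W b (\<lambda>ws. \<omega> xs (a # ws)) ys - ?W b (\<lambda>zs. \<omega> (a # zs) ys) xs)
      + ?W b (\<lambda>zs. ?W b (\<lambda>ws. \<omega> (a # zs) (a # ws)) ys) xs" for a b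
    using wedge_lincomb_right[of "covector b" "b \<bullet> a" "\<lambda>zs. \<omega> (a # zs) ys" "- 1"
        "\<lambda>zs. wedge (covector b) (\<lambda>ws. \<omega> (a # zs) (a # ws)) ys" xs]
    by (simp add: right_diff_distrib)
  have "contraction B (dform_mult (metric B) \<omega>) xs ys =
     (\<Sum>a\<in>B. (a \<bullet> a) * \<omega> xs ys - ?W a (\<lambda>ws. \<omega> xs (a # ws)) ys - ?W a (\<lambda>zs. \<omega> (a # zs) ys) xs) +
     (\<Sum>a\<in>B. \<Sum>b\<in>B. ?W b (\<lambda>zs. ?W b (\<lambda>ws. \<omega> (a # zs) (a # ws)) ys) xs)"
    unfolding contraction_def dform_mult_metric_eq term_eq sum.distrib
    by (intro arg_cong2[where f = "(+)"] sum.cong refl) (simp add: sum_delta_B)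
  also have "(\<Sum>a\<in>B. \<Sum>b\<in>B. ?W b (\<lambda>zs. ?W b (\<lambda>ws. \<omega> (a # zs) (a # ws)) ys) xs) =
      dform_mult (metric B) (contraction B \<omega>) xs ys"
    unfolding dform_mult_metric_eq contraction_def wedge_sum_right by (rule sum.swap)
  also have "(\<Sum>a\<in>B. (a \<bullet> a) * \<omega> xs ys - ?W a (\<lambda>ws. \<omega> xs (a # ws)) ys - ?W a (\<lambda>zs. \<omega> (a # zs) ys) xs) =
     (real (card B) - real p - real q) * \<omega> xs ys"
    unfolding sum_subtractf sum_wedge_covector_Cons[OF double_formsD(2)[OF assms]]
      sum_wedge_covector_Cons[OF double_formsD(1)[OF assms]]
    by (simp add: inner_B left_diff_distrib)
  finally show "contraction B (dform_mult (metric B) \<omega>) xs ys =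
      dform_mult (metric B) (contraction B \<omega>) xs ys + (real (card B) - real p - real q) * \<omega> xs ys"
    by simp
qed

lemma alt_forms_eq_0_on_basis:
  assumes "\<alpha> \<in> alt_forms p" "\<And>bs. set bs \<subseteq> B \<Longrightarrow> \<alpha> bs = 0"
  shows "\<alpha> xs = 0"
  using assms
proof (induction xs arbitrary: \<alpha> p)
  case (Cons x xs)
  have "\<alpha> (b # xs) = 0" if "b \<in> B" for b
    using Cons.IH[OF alt_forms_Cons[OF Cons.prems(1)], of b] Cons.prems(2) that by simp
  then show ?case
    using basis_expand[OF linear_alt_forms_Cons[OF Cons.prems(1)], of x xs] by simp
qed simp

text \<open>It suffices to test lists of basis vectors, and by the pigeonhole principle such a list
  of length \<open>p\<close> has a repetition.\<close>

lemma double_forms_eq_0: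
  fixes \<omega> :: "'a double_form"
  assumes "\<omega> \<in> double_forms p q" "card B < p"
  shows "\<omega> = (\<lambda>xs ys. 0)"
proof (intro ext)
  fix xs ys
  show "\<omega> xs ys = 0"
  proof (rule alt_forms_eq_0_on_basis[where \<alpha> = "\<lambda>xs. \<omega> xs ys"])
    show "(\<lambda>xs. \<omega> xs ys) \<in> alt_forms p" by (rule double_formsD(1)[OF assms(1)])
  next
    fix bs assume "set bs \<subseteq> B"
    then have "card (set bs) \<le> card B" by (simp add: card_mono)
    then have "length bs \<noteq> p \<or> \<not> distinct bs" using assms(2) distinct_card by fastforce
    then show "\<omega> bs ys = 0"
      using double_formsD(1)[OF assms(1)] alt_forms_length alt_forms_not_distinct by blast
  qed
qed

section \<open>Adjointness of multiplication by the metric and contraction\<close>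

lemma sum_basis_lists_Suc:
  "(\<Sum>xs\<in>basis_lists B (Suc p). f xs) = (\<Sum>b\<in>B. \<Sum>xs\<in>basis_lists B p. f (b # xs))"
proof -
  have "basis_lists B (Suc p) = (\<lambda>(b, xs). b # xs) ` (B \<times> basis_lists B p)"
    by (auto simp: length_Suc_conv image_iff)
  moreover have "inj_on (\<lambda>(b, xs). b # xs) (B \<times> basis_lists B p)" by (auto simp: inj_on_def)
  ultimately show ?thesis by (simp add: sum.reindex sum.cartesian_product case_prod_unfold)
qed

lemma basis_lists_0: "basis_lists B 0 = {[]}" by auto

text \<open>Wedging with \<open>b\<close> is adjoint to inserting \<open>b\<close>. The factor
  \<open>Suc p\<close> appears because the sums run over ordered lists without the normalising
  factorials of \<open>dform_inner\<close>.\<close>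

lemma wedge_covector_adjoint:
  assumes "\<beta> \<in> alt_forms (Suc p)" "b \<in> B"
  shows "(\<Sum>xs\<in>basis_lists B (Suc p). wedge (covector b) \<alpha> xs * \<beta> xs) =
    real (Suc p) * (\<Sum>xs\<in>basis_lists B p. \<alpha> xs * \<beta> (b # xs))"
  using assms(1)
proof (induction p arbitrary: \<alpha> \<beta>)
  case 0
  show ?case
    using sum_delta_B(2)[OF assms(2), of "\<lambda>x. \<alpha> [] * \<beta> [x]"]
    unfolding sum_basis_lists_Suc basis_lists_0 by (simp add: mult.assoc)
next
  case (Suc p)
  have "(\<Sum>xs\<in>basis_lists B (Suc (Suc p)). wedge (covector b) \<alpha> xs * \<beta> xs) =
    (\<Sum>x\<in>B. (b \<bullet> x) * (\<Sum>xs\<in>basis_lists B (Suc p). \<alpha> xs * \<beta> (x # xs))) -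
    (\<Sum>x\<in>B. \<Sum>xs\<in>basis_lists B (Suc p). wedge (covector b) (\<lambda>zs. \<alpha> (x # zs)) xs * \<beta> (x # xs))"
    by (subst sum_basis_lists_Suc)
      (simp add: left_diff_distrib sum_subtractf sum_distrib_left mult.assoc)
  also have "(\<Sum>x\<in>B. (b \<bullet> x) * (\<Sum>xs\<in>basis_lists B (Suc p). \<alpha> xs * \<beta> (x # xs))) =
    (\<Sum>xs\<in>basis_lists B (Suc p). \<alpha> xs * \<beta> (b # xs))"
    by (rule sum_delta_B(2)[OF assms(2)])
  also have "(\<Sum>x\<in>B. \<Sum>xs\<in>basis_lists B (Suc p). wedge (covector b) (\<lambda>zs. \<alpha> (x # zs)) xs * \<beta> (x # xs)) =
    (\<Sum>x\<in>B. real (Suc p) * (\<Sum>xs\<in>basis_lists B p. \<alpha> (x # xs) * \<beta> (x # b # xs)))"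
    using Suc.IH[OF alt_forms_Cons[OF Suc.prems, simplified]] by (intro sum.cong refl) simp
  \<comment> \<open>The swap moves \<open>b\<close> to the front, and the sums over \<open>x\<close>
    and \<open>xs\<close> combine to one over lists of length \<open>Suc p\<close>.\<close>
  also have "\<dots> = - real (Suc p) * (\<Sum>xs\<in>basis_lists B (Suc p). \<alpha> xs * \<beta> (b # xs))"
    unfolding sum_basis_lists_Suc alt_forms_swap[OF Suc.prems, of _ b]
    by (simp add: sum_negf del: of_nat_Suc flip: sum_distrib_left)
  finally show ?case by (simp add: algebra_simps)
qed

text \<open>Adjointness is applied in each argument for every summand of the metric; the factors
  \<open>Suc p\<close> and \<open>Suc q\<close> cancel against the larger factorials.\<close>

lemma dform_inner_metric:
  assumes "\<theta> \<in> double_forms (Suc p) (Suc q)"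
  shows "dform_inner B (Suc p) (Suc q) (dform_mult (metric B) \<omega>) \<theta> =
    dform_inner B p q \<omega> (contraction B \<theta>)"
proof -
  let ?W = "\<lambda>b. wedge (covector b)"
  have swap: "(\<Sum>b\<in>B. \<Sum>xs\<in>basis_lists B p. \<Sum>ys\<in>basis_lists B q. \<omega> xs ys * \<theta> (b # xs) (b # ys)) =
      (\<Sum>xs\<in>basis_lists B p. \<Sum>ys\<in>basis_lists B q. \<omega> xs ys * contraction B \<theta> xs ys)"
    unfolding contraction_def sum_distrib_left
    by (subst sum.swap, subst (2) sum.swap) (rule refl)
  have "(\<Sum>xs\<in>basis_lists B (Suc p). \<Sum>ys\<in>basis_lists B (Suc q).
        dform_mult (metric B) \<omega> xs ys * \<theta> xs ys) =
    (\<Sum>b\<in>B. \<Sum>ys\<in>basis_lists B (Suc q). \<Sum>xs\<in>basis_lists B (Suc p).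
        ?W b (\<lambda>us. ?W b (\<omega> us) ys) xs * \<theta> xs ys)"
    unfolding dform_mult_metric_eq sum_distrib_right
    by (subst sum.swap, subst (2) sum.swap, subst (1) sum.swap) (rule refl)
  also have "\<dots> = (\<Sum>b\<in>B. \<Sum>ys\<in>basis_lists B (Suc q).
        real (Suc p) * (\<Sum>xs\<in>basis_lists B p. ?W b (\<omega> xs) ys * \<theta> (b # xs) ys))"
    by (intro sum.cong refl wedge_covector_adjoint double_formsD(1)[OF assms])
  also have "\<dots> = real (Suc p) * (\<Sum>b\<in>B. \<Sum>xs\<in>basis_lists B p. \<Sum>ys\<in>basis_lists B (Suc q).
        ?W b (\<omega> xs) ys * \<theta> (b # xs) ys)"
    unfolding sum_distrib_left[symmetric] by (subst (2) sum.swap) (rule refl)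
  also have "\<dots> = real (Suc p) * (\<Sum>b\<in>B. \<Sum>xs\<in>basis_lists B p.
      real (Suc q) * (\<Sum>ys\<in>basis_lists B q. \<omega> xs ys * \<theta> (b # xs) (b # ys)))"
    by (intro sum.cong refl wedge_covector_adjoint double_formsD(2)[OF assms] arg_cong2[where f = "(*)"])
  also have "\<dots> = real (Suc p) * real (Suc q) *
      (\<Sum>xs\<in>basis_lists B p. \<Sum>ys\<in>basis_lists B q. \<omega> xs ys * contraction B \<theta> xs ys)"
    unfolding sum_distrib_left[symmetric] swap mult.assoc ..
  finally show ?thesis by (simp add: dform_inner_def)
qed

end

section \<open>Effective components\<close>

text \<open>Telescoping with the convention that the term before \<open>T 0\<close> is 0, as needed
  for both sums over \<open>proj_coeff\<close>.\<close>

lemma sum_telescope_case: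
  fixes T :: "nat \<Rightarrow> real"
  shows "(\<Sum>r\<le>m. T r - (case r of 0 \<Rightarrow> 0 | Suc s \<Rightarrow> T s)) = T m"
  by (induction m) simp_all

lemma prod_falling_eq_0: "l < m \<Longrightarrow> (\<Prod>i<m. (real l - real i) * f i) = 0"
  by (intro prod_zero) (auto intro!: bexI[of _ l])

text \<open>The coefficients of the extremal projector of \<open>sl_2\<close>; \<open>x\<close>
  stands for the weight \<open>n - 2k\<close>.\<close>

definition proj_coeff :: "real \<Rightarrow> nat \<Rightarrow> real" where
  "proj_coeff x r = (-1) ^ r / (fact r * (\<Prod>i<r. x + 2 + real i))"

lemma proj_coeff_0 [simp]: "proj_coeff x 0 = 1"
  by (simp add: proj_coeff_def)

text \<open>The recurrence that makes neighbouring terms cancel; \<open>0 \<le> x\<close> keeps the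
  denominators away from 0.\<close>

lemma proj_coeff_Suc:
  assumes "0 \<le> x"
  shows "proj_coeff x (Suc r) * (real (Suc r) * (x + 2 + real r)) = - proj_coeff x r"
proof -
  have "- s / (real (Suc r) * f * (P * y)) * (real (Suc r) * y) = - (s / (f * P))"
    if "y \<noteq> 0" for s f P y :: real
    using that by (simp add: divide_simps del: of_nat_Suc)
  moreover have "x + 2 + real r \<noteq> 0" using assms by auto
  ultimately show ?thesis by (simp add: proj_coeff_def del: of_nat_Suc)
qed

lemma dform_inner_commute: "dform_inner B p q \<omega> \<theta> = dform_inner B p q \<theta> \<omega>"
  by (simp add: dform_inner_def mult.commute)

lemma dform_inner_zero_right: "dform_inner B p q \<omega> (\<lambda>xs ys. 0) = 0"
  by (simp add: dform_inner_def)

context euclidean_basis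
begin

abbreviation "g_mult \<equiv> dform_mult (metric B)"
abbreviation "contr \<equiv> contraction B"
abbreviation "dfm (p::nat) \<equiv> (double_forms p p :: 'a double_form set)"
abbreviation "nB \<equiv> real (card B)"

lemmas linear_g = dform_linear_dform_mult[of "metric B"]
lemmas linear_contr = dform_linear_contraction[of B]
lemmas linear_g_pow = dform_linear_funpow[OF linear_g]
lemmas linear_contr_pow = dform_linear_funpow[OF linear_contr]

lemma g_pow_dfm: "\<omega> \<in> dfm k \<Longrightarrow> (g_mult ^^ r) \<omega> \<in> dfm (k + r)"
  by (rule funpow_dform_mult_metric_double_forms)

lemma contr_pow_dfm: "\<omega> \<in> dfm k \<Longrightarrow> (contr ^^ r) \<omega> \<in> dfm (k - r)"
  by (rule funpow_contraction_double_forms)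

section \<open>Commutators with powers of the metric and of the contraction\<close>

lemma contr_g:
  "\<omega> \<in> dfm k \<Longrightarrow> contr (g_mult \<omega>) =
     (\<lambda>xs ys. g_mult (contr \<omega>) xs ys + (nB - 2 * real k) * \<omega> xs ys)"
  by (simp add: contraction_dform_mult_metric[of \<omega> k k])

text \<open>Moving the contraction past \<open>r\<close> factors picks up
  \<open>nB - 2 * (k + i)\<close> for each \<open>i < r\<close>; these add up to the coefficient. It
  is 0 for \<open>r = 0\<close>, where \<open>r - 1\<close> is truncated.\<close>

lemma contr_g_pow:
  assumes "\<omega> \<in> dfm k"
  shows "contr ((g_mult ^^ r) \<omega>) = (\<lambda>xs ys. (g_mult ^^ r) (contr \<omega>) xs ys +
     real r * (nB - 2 * real k - real r + 1) * (g_mult ^^ (r - 1)) \<omega> xs ys)"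
proof (induction r)
  case (Suc r)
  have "contr ((g_mult ^^ Suc r) \<omega>) = (\<lambda>xs ys. g_mult (contr ((g_mult ^^ r) \<omega>)) xs ys +
      (nB - 2 * real (k + r)) * (g_mult ^^ r) \<omega> xs ys)"
    using contr_g[OF g_pow_dfm[OF assms]] by simp
  also have "g_mult (contr ((g_mult ^^ r) \<omega>)) =
      (\<lambda>xs ys. (g_mult ^^ Suc r) (contr \<omega>) xs ys +
        (real r * (nB - 2 * real k - real r + 1)) * g_mult ((g_mult ^^ (r - 1)) \<omega>) xs ys)"
    unfolding Suc.IH
    using dform_linear_lincomb[OF linear_g, of 1 "(g_mult ^^ r) (contr \<omega>)"] by simp
  also have "\<dots> = (\<lambda>xs ys. (g_mult ^^ Suc r) (contr \<omega>) xs ys +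
        (real r * (nB - 2 * real k - real r + 1)) * (g_mult ^^ r) \<omega> xs ys)"
    by (cases r) simp_all
  finally show ?case by (simp add: algebra_simps)
qed simp

text \<open>Here the metric is commuted in the degrees \<open>k\<close>, \<open>k - 1\<close>, ...,
  \<open>k - r\<close>, and the numbers \<open>nB - 2 * (k - i)\<close> for \<open>i \<le> r\<close>
  add up to the coefficient.\<close>

lemma contr_pow_g:
  assumes "\<zeta> \<in> dfm k"
  shows "(contr ^^ Suc r) (g_mult \<zeta>) = (\<lambda>xs ys. g_mult ((contr ^^ Suc r) \<zeta>) xs ys +
     real (Suc r) * (nB - 2 * real k + real r) * (contr ^^ r) \<zeta> xs ys)"
proof (induction r)
  case 0
  show ?case using contr_g[OF assms] by simp
next
  case (Suc r)
  let ?\<eta> = "(contr ^^ Suc r) \<zeta>"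
  have "(contr ^^ Suc (Suc r)) (g_mult \<zeta>) = (\<lambda>xs ys. contr (g_mult ?\<eta>) xs ys +
     (real (Suc r) * (nB - 2 * real k + real r)) * ?\<eta> xs ys)"
    using dform_linear_lincomb[OF linear_contr, of 1 "g_mult ?\<eta>" _ "(contr ^^ r) \<zeta>"] Suc.IH
    by simp
  also have "contr (g_mult ?\<eta>) = (\<lambda>xs ys. g_mult (contr ?\<eta>) xs ys + (nB - 2 * real (k - Suc r)) * ?\<eta> xs ys)"
    by (rule contr_g[OF contr_pow_dfm[OF assms]])
  finally have *: "(contr ^^ Suc (Suc r)) (g_mult \<zeta>) = (\<lambda>xs ys. g_mult (contr ?\<eta>) xs ys +
      (nB - 2 * real (k - Suc r)) * ?\<eta> xs ys + (real (Suc r) * (nB - 2 * real k + real r)) * ?\<eta> xs ys)" .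
  \<comment> \<open>When \<open>k < Suc r\<close> the truncated \<open>k - Suc r\<close> gives
    another coefficient, but then \<open>?\<eta>\<close> is 0.\<close>
  show ?case
  proof (cases "Suc r \<le> k")
    case True
    then have "real (k - Suc r) = real k - real r - 1" by (simp add: of_nat_diff)
    then show ?thesis unfolding * by (simp add: algebra_simps)
  next
    case False
    then have "?\<eta> = (\<lambda>xs ys. 0)" using funpow_contraction_eq_0[OF assms, of "Suc r"] by simp
    then show ?thesis unfolding * by simp
  qed
qed

section \<open>The projection to effective forms\<close>

definition eff_proj :: "nat \<Rightarrow> 'a double_form \<Rightarrow> 'a double_form" where
  "eff_proj k \<eta> = (\<lambda>xs ys. \<Sum>r\<le>k. proj_coeff (nB - 2 * real k) r * (g_mult ^^ r) ((contr ^^ r) \<eta>) xs ys)"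

lemma linear_eff_proj: "dform_linear (eff_proj k)"
  unfolding dform_linear_def eff_proj_def
    dform_linear_lincomb[OF linear_contr_pow] dform_linear_lincomb[OF linear_g_pow]
  by (simp add: sum.distrib sum_distrib_left distrib_left mult.left_commute)

lemma eff_proj_dfm: "\<eta> \<in> dfm k \<Longrightarrow> eff_proj k \<eta> \<in> dfm k"
  unfolding eff_proj_def
  using g_pow_dfm[OF contr_pow_dfm] by (intro double_forms_sum double_forms_scale) (metis le_add_diff_inverse2 atMost_iff)

text \<open>By \<open>contr_g_pow\<close> each summand splits into a term with
  \<open>g^r c^(r+1)\<close> and one with \<open>g^(r-1) c^r\<close>. Neighbours cancel, and the
  term left over has \<open>k + 1\<close> contractions of a form of degree \<open>k\<close>.\<close>

lemma contr_eff_proj: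
  assumes "\<eta> \<in> dfm k" "2 * k \<le> card B"
  shows "contr (eff_proj k \<eta>) = (\<lambda>xs ys. 0)"
proof (intro ext)
  fix xs ys
  let ?x = "nB - 2 * real k"
  define T where "T r = proj_coeff ?x r * (g_mult ^^ r) ((contr ^^ Suc r) \<eta>) xs ys" for r
  have x: "0 \<le> ?x" using assms(2) by linarith
  have "proj_coeff ?x r * contr ((g_mult ^^ r) ((contr ^^ r) \<eta>)) xs ys =
      T r - (case r of 0 \<Rightarrow> 0 | Suc s \<Rightarrow> T s)" if "r \<le> k" for r
  proof (cases r)
    case (Suc s)
    \<comment> \<open>As \<open>c^r\<close> has lowered the degree to \<open>k - r\<close>, the
      commutator coefficient is exactly the factor in \<open>proj_coeff_Suc\<close>.\<close>
    have coeff: "real r * (nB - 2 * real (k - r) - real r + 1) = real (Suc s) * (?x + 2 + real s)"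
      using that Suc by (simp add: of_nat_diff)
    have "proj_coeff ?x r * contr ((g_mult ^^ r) ((contr ^^ r) \<eta>)) xs ys =
        T r + proj_coeff ?x r * (real (Suc s) * (?x + 2 + real s)) * (g_mult ^^ s) ((contr ^^ r) \<eta>) xs ys"
      unfolding contr_g_pow[OF contr_pow_dfm[OF assms(1)]] coeff T_def
      by (simp add: Suc distrib_left mult.assoc)
    also have "\<dots> = T r - T s"
      unfolding Suc proj_coeff_Suc[OF x] T_def by simp
    finally show ?thesis using Suc by simp
  qed (simp add: T_def)
  then have "contr (eff_proj k \<eta>) xs ys = (\<Sum>r\<le>k. T r - (case r of 0 \<Rightarrow> 0 | Suc s \<Rightarrow> T s))"
    unfolding eff_proj_def dform_linear_sum[OF linear_contr] by (intro sum.cong refl) simp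
  also have "\<dots> = 0"
    unfolding sum_telescope_case T_def funpow_contraction_eq_0[OF assms(1) lessI]
    by (simp add: dform_linear_zero[OF linear_g_pow])
  finally show "contr (eff_proj k \<eta>) xs ys = 0" .
qed

text \<open>The mirror image of \<open>contr_eff_proj\<close>: the contractions are moved past the
  factor on their right by \<open>contr_pow_g\<close>. It serves to remove the components of lower
  index.\<close>

lemma eff_proj_g:
  assumes "\<zeta> \<in> dfm j" "2 * Suc j \<le> card B"
  shows "eff_proj (Suc j) (g_mult \<zeta>) = (\<lambda>xs ys. 0)"
proof (intro ext)
  fix xs ys
  let ?x = "nB - 2 * real (Suc j)"
  define T where "T r = proj_coeff ?x r * (g_mult ^^ Suc r) ((contr ^^ r) \<zeta>) xs ys" for r
  have x: "0 \<le> ?x" using assms(2) by linarith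
  have "proj_coeff ?x r * (g_mult ^^ r) ((contr ^^ r) (g_mult \<zeta>)) xs ys =
      T r - (case r of 0 \<Rightarrow> 0 | Suc s \<Rightarrow> T s)" for r
  proof (cases r)
    case (Suc s)
    have coeff: "real (Suc s) * (nB - 2 * real j + real s) = real (Suc s) * (?x + 2 + real s)" by simp
    have "(g_mult ^^ r) ((contr ^^ r) (g_mult \<zeta>)) =
      (g_mult ^^ r) (\<lambda>xs ys. 1 * g_mult ((contr ^^ r) \<zeta>) xs ys +
        real (Suc s) * (?x + 2 + real s) * (contr ^^ s) \<zeta> xs ys)"
      unfolding Suc contr_pow_g[OF assms(1)] coeff by simp
    also have "\<dots> = (\<lambda>xs ys. 1 * (g_mult ^^ r) (g_mult ((contr ^^ r) \<zeta>)) xs ys +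
        real (Suc s) * (?x + 2 + real s) * (g_mult ^^ r) ((contr ^^ s) \<zeta>) xs ys)"
      by (rule dform_linear_lincomb[OF linear_g_pow])
    finally have "proj_coeff ?x r * (g_mult ^^ r) ((contr ^^ r) (g_mult \<zeta>)) xs ys =
        T r + proj_coeff ?x r * (real (Suc s) * (?x + 2 + real s)) * (g_mult ^^ r) ((contr ^^ s) \<zeta>) xs ys"
      by (simp only: T_def funpow_Suc_right o_apply distrib_left[of "proj_coeff _ _"] mult.assoc mult_1)
    also have "\<dots> = T r - T s"
      unfolding Suc proj_coeff_Suc[OF x] T_def by simp
    finally show ?thesis using Suc by simp
  qed (simp add: T_def)
  then have "eff_proj (Suc j) (g_mult \<zeta>) xs ys = (\<Sum>r\<le>Suc j. T r - (case r of 0 \<Rightarrow> 0 | Suc s \<Rightarrow> T s))"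
    unfolding eff_proj_def by (intro sum.cong refl) simp
  also have "\<dots> = 0"
    unfolding sum_telescope_case T_def funpow_contraction_eq_0[OF assms(1) lessI]
    by (simp only: dform_linear_zero[OF linear_g_pow])
  finally show "eff_proj (Suc j) (g_mult \<zeta>) xs ys = 0" .
qed

lemma eff_proj_effective:
  assumes "contr w = (\<lambda>xs ys. 0)"
  shows "eff_proj k w = w"
proof (intro ext)
  fix xs ys
  have "(contr ^^ Suc r) w = (\<lambda>xs ys. 0)" for r
    using assms by (simp add: funpow_Suc_right dform_linear_zero[OF linear_contr_pow] del: funpow.simps)
  then have "(g_mult ^^ Suc r) ((contr ^^ Suc r) w) xs ys = 0" for r
    by (simp only: dform_linear_zero[OF linear_g_pow])
  then show "eff_proj k w xs ys = w xs ys"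
    unfolding eff_proj_def sum.atMost_shift by simp
qed

text \<open>The summand of \<open>eff_proj\<close> for \<open>r = 0\<close> is \<open>\<eta>\<close>
  itself. All others begin with a factor \<open>g\<close>, and removing it, with a change of sign,
  gives \<open>\<zeta>\<close>.\<close>

lemma eff_proj_remainder:
  assumes "\<eta> \<in> dfm (Suc j)"
  shows "\<exists>\<zeta>\<in>dfm j. \<eta> = (\<lambda>xs ys. eff_proj (Suc j) \<eta> xs ys + g_mult \<zeta> xs ys)"
proof
  let ?a = "proj_coeff (nB - 2 * real (Suc j))"
  let ?\<zeta> = "\<lambda>xs ys. \<Sum>r<Suc j. - ?a (Suc r) * (g_mult ^^ r) ((contr ^^ Suc r) \<eta>) xs ys"
  have "(g_mult ^^ r) ((contr ^^ Suc r) \<eta>) \<in> dfm j" if "r < Suc j" for r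
    using g_pow_dfm[OF contr_pow_dfm[OF assms], of r "Suc r"] that by simp
  then show "?\<zeta> \<in> dfm j"
    by (intro double_forms_sum double_forms_scale) auto
  have "g_mult ?\<zeta> xs ys = \<eta> xs ys - eff_proj (Suc j) \<eta> xs ys" for xs ys
    unfolding dform_linear_sum[OF linear_g] eff_proj_def sum.atMost_shift
    by (simp add: sum_negf)
  then show "\<eta> = (\<lambda>xs ys. eff_proj (Suc j) \<eta> xs ys + g_mult ?\<zeta> xs ys)" by auto
qed

text \<open>Iteration of \<open>contr_g_pow\<close>, whose first term drops out for effective forms.
  If \<open>l < m\<close>, the factor with \<open>i = l\<close> is 0, so the truncated exponent does
  no harm.\<close>

lemma contr_pow_g_pow_effective:
  assumes "w \<in> dfm k" "contr w = (\<lambda>xs ys. 0)"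
  shows "(contr ^^ m) ((g_mult ^^ l) w) =
    (\<lambda>xs ys. (\<Prod>i<m. (real l - real i) * (nB - 2 * real k - real l + 1 + real i)) *
       (g_mult ^^ (l - m)) w xs ys)"
proof (induction m)
  case (Suc m)
  have *: "contr ((g_mult ^^ (l - m)) w) = (\<lambda>xs ys. real (l - m) *
      (nB - 2 * real k - real (l - m) + 1) * (g_mult ^^ (l - Suc m)) w xs ys)"
    unfolding contr_g_pow[OF assms(1)] assms(2) dform_linear_zero[OF linear_g_pow] by simp
  show ?case
  proof (cases "m \<le> l")
    case True
    then have "real (l - m) * (nB - 2 * real k - real (l - m) + 1) =
        (real l - real m) * (nB - 2 * real k - real l + 1 + real m)"
      by (simp add: of_nat_diff)
    then show ?thesis
      by (simp only: funpow.simps o_apply Suc.IH dform_linear_scale[OF linear_contr] *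
          prod.lessThan_Suc mult.assoc)
  next
    case False
    then have "l < Suc m" "real (l - m) = 0" by auto
    then show ?thesis
      by (simp only: funpow.simps o_apply Suc.IH dform_linear_scale[OF linear_contr] *
          prod_falling_eq_0 mult_zero_left mult_zero_right)
  qed
qed simp

section \<open>Vanishing for reasons of degree\<close>

lemma g_pow_eq_0: "\<omega> \<in> dfm k \<Longrightarrow> card B < k + r \<Longrightarrow> (g_mult ^^ r) \<omega> = (\<lambda>xs ys. 0)"
  by (rule double_forms_eq_0[OF g_pow_dfm])

text \<open>For \<open>s = n + 1\<close> the form \<open>g^s w\<close> is 0 by its degree, whereas
  \<open>c^s\<close> brings back a multiple of \<open>w\<close>. The multiple is nonzero, since
  \<open>n < 2m\<close> makes the second factors negative.\<close>

lemma effective_eq_0: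
  assumes "w \<in> dfm m" "contr w = (\<lambda>xs ys. 0)" "card B < 2 * m"
  shows "w = (\<lambda>xs ys. 0)"
proof -
  let ?s = "Suc (card B)"
  let ?K = "\<Prod>i<?s. (real ?s - real i) * (nB - 2 * real m - real ?s + 1 + real i)"
  have "(real ?s - real i) * (nB - 2 * real m - real ?s + 1 + real i) \<noteq> 0" if "i < ?s" for i
  proof -
    have "real ?s - real i > 0" "nB - 2 * real m - real ?s + 1 + real i < 0"
      using assms(3) that by linarith+
    then show ?thesis by auto
  qed
  then have "?K \<noteq> 0" by (subst prod_zero_iff) blast+
  moreover have "(\<lambda>xs ys. ?K * w xs ys) = (\<lambda>xs ys. 0)"
    using contr_pow_g_pow_effective[OF assms(1,2), of ?s ?s] g_pow_eq_0[OF assms(1), of ?s]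
    by (simp add: dform_linear_zero[OF linear_contr_pow] del: funpow.simps prod.lessThan_Suc)
  ultimately show ?thesis by (metis (no_types, lifting) mult_eq_0_iff)
qed

lemma g_pow_effective_eq_0:
  assumes "w \<in> dfm k" "contr w = (\<lambda>xs ys. 0)" "k \<le> p" "card B < p + k"
  shows "(g_mult ^^ (p - k)) w = (\<lambda>xs ys. 0)"
proof (cases "card B < 2 * k")
  case True
  then show ?thesis using effective_eq_0[OF assms(1,2)] by (simp add: dform_linear_zero[OF linear_g_pow])
next
  case False
  \<comment> \<open>The positive exponent at which the coefficient in \<open>contr_g_pow\<close>
    vanishes: \<open>g^l w\<close> is again effective, but of degree \<open>n - k + 1\<close>, above
    the middle, hence 0.\<close>
  define l where "l = Suc (card B - 2 * k)"
  have "real l = nB - 2 * real k + 1" using False by (simp add: l_def of_nat_diff)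
  then have "contr ((g_mult ^^ l) w) = (\<lambda>xs ys. 0)"
    unfolding contr_g_pow[OF assms(1)] assms(2) dform_linear_zero[OF linear_g_pow] by simp
  then have "(g_mult ^^ l) w = (\<lambda>xs ys. 0)"
    using False by (intro effective_eq_0[OF g_pow_dfm[OF assms(1)]]) (simp_all add: l_def)
  moreover have "p - k = (p - k - l) + l" using assms(3,4) False by (simp add: l_def)
  ultimately show ?thesis
    by (metis dform_linear_zero[OF linear_g_pow] funpow_add o_apply)
qed

section \<open>Surjectivity of multiplication by the metric above the middle degree\<close>

lemma contr_pow_g_pow_Suc:
  assumes "\<zeta> \<in> dfm q"
  shows "\<exists>\<eta>\<in>dfm q. (contr ^^ s) ((g_mult ^^ Suc s) \<zeta>) = g_mult \<eta>"
  using assms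
proof (induction s arbitrary: \<zeta>)
  case (Suc s)
  let ?a = "real (Suc (Suc s)) * (nB - 2 * real q - real (Suc (Suc s)) + 1)"
  have "g_mult (contr \<zeta>) \<in> dfm q"
  proof (cases q)
    case 0
    then have "contr \<zeta> = (\<lambda>xs ys. 0)" using Suc.prems contraction_double_forms_0 by blast
    then show ?thesis by (simp add: dform_linear_zero[OF linear_g] double_forms_zero)
  next
    case (Suc r)
    then show ?thesis
      using dform_mult_metric_double_forms[OF contraction_double_forms[OF Suc.prems]] by simp
  qed
  with Suc obtain \<eta>1 \<eta>2 where \<eta>: "\<eta>1 \<in> dfm q" "\<eta>2 \<in> dfm q"
    "(contr ^^ s) ((g_mult ^^ Suc s) (g_mult (contr \<zeta>))) = g_mult \<eta>1"
    "(contr ^^ s) ((g_mult ^^ Suc s) \<zeta>) = g_mult \<eta>2" by meson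
  \<comment> \<open>Moving one contraction to the right leaves two terms of the shape treated for
    \<open>s\<close>, built from \<open>g_mult (contr \<zeta>)\<close> and \<open>\<zeta>\<close>,
    both of degree \<open>q\<close>.\<close>
  have "(contr ^^ Suc s) ((g_mult ^^ Suc (Suc s)) \<zeta>) =
      (contr ^^ s) (\<lambda>xs ys. 1 * (g_mult ^^ Suc s) (g_mult (contr \<zeta>)) xs ys + ?a * (g_mult ^^ Suc s) \<zeta> xs ys)"
    unfolding funpow_Suc_right[of s contr] o_apply contr_g_pow[OF Suc.prems]
    by (simp add: funpow_swap1 del: of_nat_Suc)
  also have "\<dots> = g_mult (\<lambda>xs ys. 1 * \<eta>1 xs ys + ?a * \<eta>2 xs ys)"
    unfolding dform_linear_lincomb[OF linear_contr_pow] \<eta> dform_linear_lincomb[OF linear_g] ..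
  finally show ?case using double_forms_lincomb[OF \<eta>(1,2)] by blast
qed auto

text \<open>Modulo multiples of the metric only the scalars in the commutators survive; the term in
  which a contraction reaches \<open>\<omega>\<close> is handled by
  \<open>contr_pow_g_pow_Suc\<close>.\<close>

lemma contr_pow_g_pow_mod_g:
  assumes "\<omega> \<in> dfm p"
  shows "\<exists>\<eta>\<in>dfm (p - 1). (contr ^^ s) ((g_mult ^^ s) \<omega>) =
    (\<lambda>xs ys. (\<Prod>i<s. real (Suc i) * (nB - 2 * real p - real i)) * \<omega> xs ys + g_mult \<eta> xs ys)"
proof (induction s)
  case 0
  show ?case using double_forms_zero dform_linear_zero[OF linear_g] by force
next
  case (Suc s)
  let ?K = "\<lambda>s. \<Prod>i<s. real (Suc i) * (nB - 2 * real p - real i)"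
  let ?a = "real (Suc s) * (nB - 2 * real p - real s)"
  obtain \<eta>1 \<eta>2 where \<eta>: "\<eta>1 \<in> dfm (p - 1)" "\<eta>2 \<in> dfm (p - 1)"
    "(contr ^^ s) ((g_mult ^^ Suc s) (contr \<omega>)) = g_mult \<eta>1"
    "(contr ^^ s) ((g_mult ^^ s) \<omega>) = (\<lambda>xs ys. ?K s * \<omega> xs ys + g_mult \<eta>2 xs ys)"
    using Suc.IH contr_pow_g_pow_Suc[OF contraction_double_forms[OF assms]] by meson
  have coeff: "nB - 2 * real p - real (Suc s) + 1 = nB - 2 * real p - real s" by simp
  have "(contr ^^ Suc s) ((g_mult ^^ Suc s) \<omega>) =
      (contr ^^ s) (\<lambda>xs ys. 1 * (g_mult ^^ Suc s) (contr \<omega>) xs ys + ?a * (g_mult ^^ s) \<omega> xs ys)"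
    unfolding funpow_Suc_right[of s contr] o_apply contr_g_pow[OF assms] coeff
    by (simp del: funpow.simps of_nat_Suc)
  also have "\<dots> = (\<lambda>xs ys. 1 * g_mult \<eta>1 xs ys + ?a * (?K s * \<omega> xs ys + g_mult \<eta>2 xs ys))"
    unfolding dform_linear_lincomb[OF linear_contr_pow] \<eta>(3,4) ..
  also have "\<dots> = (\<lambda>xs ys. ?K (Suc s) * \<omega> xs ys + (1 * g_mult \<eta>1 xs ys + ?a * g_mult \<eta>2 xs ys))"
    by (simp add: algebra_simps)
  finally show ?case
    using double_forms_lincomb[OF \<eta>(1,2), of 1 ?a] dform_linear_lincomb[OF linear_g, of 1 \<eta>1 ?a \<eta>2]
    by force
qed

text \<open>For \<open>s = n + 1\<close> the left side of \<open>contr_pow_g_pow_mod_g\<close> is 0.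
  The scalar is not, because every \<open>nB - 2 * p - i\<close> is negative, so the equation can be
  solved for \<open>\<omega>\<close>.\<close>

lemma g_surj_above_middle:
  assumes "\<omega> \<in> dfm p" "card B < 2 * p"
  shows "\<exists>\<eta>\<in>dfm (p - 1). \<omega> = g_mult \<eta>"
proof -
  let ?s = "Suc (card B)"
  let ?K = "\<Prod>i<?s. real (Suc i) * (nB - 2 * real p - real i)"
  have "real (Suc i) * (nB - 2 * real p - real i) \<noteq> 0" for i
  proof -
    have "nB - 2 * real p - real i < 0" using assms(2) by linarith
    then show ?thesis by simp
  qed
  then have K: "?K \<noteq> 0" by (subst prod_zero_iff) blast+
  obtain \<eta> where \<eta>: "\<eta> \<in> dfm (p - 1)"
    "(contr ^^ ?s) ((g_mult ^^ ?s) \<omega>) = (\<lambda>xs ys. ?K * \<omega> xs ys + g_mult \<eta> xs ys)"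
    using contr_pow_g_pow_mod_g[OF assms(1)] by meson
  moreover have "(contr ^^ ?s) ((g_mult ^^ ?s) \<omega>) = (\<lambda>xs ys. 0)"
    using g_pow_eq_0[OF assms(1), of ?s] dform_linear_zero[OF linear_contr_pow]
    by (simp del: funpow.simps)
  ultimately have "?K * \<omega> xs ys + g_mult \<eta> xs ys = 0" for xs ys by (metis (no_types, lifting))
  then have "\<omega> xs ys = (- 1 / ?K) * g_mult \<eta> xs ys" for xs ys
    using K by (simp add: field_simps add_eq_0_iff del: prod.lessThan_Suc)
  then have "\<omega> = g_mult (\<lambda>xs ys. (- 1 / ?K) * \<eta> xs ys)"
    unfolding dform_linear_scale[OF linear_g] by blast
  then show ?thesis using double_forms_scale[OF \<eta>(1)] by blast
qed

text \<open>Up to the middle degree \<open>eff_proj\<close> splits off the top component, and what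
  remains is the metric times a form of lower degree.\<close>

lemma dform_decomposition:
  assumes "\<omega> \<in> dfm p"
  shows "\<exists>w. (\<forall>k\<le>p. w k \<in> effective_forms B k k) \<and>
    \<omega> = (\<lambda>xs ys. \<Sum>k\<le>p. (g_mult ^^ (p - k)) (w k) xs ys)"
  using assms
proof (induction p arbitrary: \<omega>)
  case 0
  then show ?case
    using contraction_double_forms_0[OF 0] by (intro exI[of _ "\<lambda>_. \<omega>"]) (simp add: effective_forms_def)
next
  case (Suc p)
  have "\<exists>v\<in>effective_forms B (Suc p) (Suc p). \<exists>\<eta>\<in>dfm p. \<omega> = (\<lambda>xs ys. v xs ys + g_mult \<eta> xs ys)"
  proof (cases "2 * Suc p \<le> card B")
    case True
    then show ?thesis
      using eff_proj_remainder[OF Suc.prems] eff_proj_dfm[OF Suc.prems] contr_eff_proj[OF Suc.prems]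
      by (fastforce simp: effective_forms_def)
  next
    \<comment> \<open>Above the middle the top component is 0 and the whole form is a multiple of
      the metric.\<close>
    case False
    then obtain \<eta> where "\<eta> \<in> dfm p" "\<omega> = g_mult \<eta>"
      using g_surj_above_middle[OF Suc.prems] by auto
    moreover have "(\<lambda>xs ys. 0) \<in> effective_forms B (Suc p) (Suc p)"
      by (simp add: effective_forms_def double_forms_zero dform_linear_zero[OF linear_contr])
    ultimately show ?thesis by force
  qed
  then obtain v \<eta> where v: "v \<in> effective_forms B (Suc p) (Suc p)" and \<eta>: "\<eta> \<in> dfm p"
    and \<omega>: "\<omega> = (\<lambda>xs ys. v xs ys + g_mult \<eta> xs ys)" by blast
  obtain w where w: "\<forall>k\<le>p. w k \<in> effective_forms B k k"
    "\<eta> = (\<lambda>xs ys. \<Sum>k\<le>p. (g_mult ^^ (p - k)) (w k) xs ys)"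
    using Suc.IH[OF \<eta>] by blast
  let ?w = "w(Suc p := v)"
  have "g_mult \<eta> = (\<lambda>xs ys. \<Sum>k\<le>p. (g_mult ^^ (Suc p - k)) (?w k) xs ys)"
    unfolding w(2)
    using dform_linear_sum[OF linear_g, of "\<lambda>_. 1" "\<lambda>k. (g_mult ^^ (p - k)) (w k)" "{..p}"]
    by (simp add: Suc_diff_le)
  then have "\<omega> = (\<lambda>xs ys. \<Sum>k\<le>Suc p. (g_mult ^^ (Suc p - k)) (?w k) xs ys)"
    unfolding \<omega> by (simp add: add.commute)
  moreover have "\<forall>k\<le>Suc p. ?w k \<in> effective_forms B k k" using v w(1) by (auto simp: le_Suc_eq)
  ultimately show ?case by blast
qed

section \<open>Orthogonality of the summands\<close>

lemma dform_inner_g_pow: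
  assumes "\<theta> \<in> dfm (q + a)"
  shows "dform_inner B (q + a) (q + a) ((g_mult ^^ a) u) \<theta> = dform_inner B q q u ((contr ^^ a) \<theta>)"
  using assms
proof (induction a arbitrary: \<theta>)
  case (Suc a)
  then have "dform_inner B (q + Suc a) (q + Suc a) ((g_mult ^^ Suc a) u) \<theta> =
      dform_inner B (q + a) (q + a) ((g_mult ^^ a) u) (contr \<theta>)"
    using dform_inner_metric[of \<theta> "q + a" "q + a"] by simp
  also have "\<dots> = dform_inner B q q u ((contr ^^ a) (contr \<theta>))"
    using Suc.IH contraction_double_forms[OF Suc.prems] by simp
  finally show ?case by (simp add: funpow_swap1)
qed simp

text \<open>Moved to the other side, \<open>g^(p-j)\<close> becomes \<open>c^(p-j)\<close>: more
  contractions than the factors in front of the effective form \<open>v\<close>, hence 0.\<close>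

lemma dform_inner_summands_less:
  assumes "j < k" "k \<le> p" "v \<in> effective_forms B k k"
  shows "dform_inner B p p ((g_mult ^^ (p - j)) u) ((g_mult ^^ (p - k)) v) = 0"
proof -
  have v: "v \<in> dfm k" "contr v = (\<lambda>xs ys. 0)" using assms(3) by (auto simp: effective_forms_def)
  have "p - k < p - j" using assms(1,2) by simp
  then have "(contr ^^ (p - j)) ((g_mult ^^ (p - k)) v) = (\<lambda>xs ys. 0)"
    by (simp only: contr_pow_g_pow_effective[OF v] prod_falling_eq_0 mult_zero_left)
  moreover have "(g_mult ^^ (p - k)) v \<in> dfm (j + (p - j))"
    using g_pow_dfm[OF v(1), of "p - k"] assms(1,2) by simp
  ultimately show ?thesis
    using dform_inner_g_pow[of "(g_mult ^^ (p - k)) v" j "p - j" u] assms(1,2)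
    by (simp add: dform_inner_zero_right)
qed

lemma dform_inner_summands:
  assumes "j \<noteq> k" "j \<le> p" "k \<le> p" "u \<in> effective_forms B j j" "v \<in> effective_forms B k k"
  shows "dform_inner B p p ((g_mult ^^ (p - j)) u) ((g_mult ^^ (p - k)) v) = 0"
  using assms dform_inner_summands_less dform_inner_commute by (metis nat_neq_iff)

section \<open>Isolating a single component\<close>

lemma prod_effective_coeff:
  assumes "k \<le> p" "p + k \<le> card B"
  shows "(\<Prod>i<p - k. (real (p - k) - real i) * (nB - 2 * real k - real (p - k) + 1 + real i)) =
    fact (p - k) * fact (card B - 2 * k) / fact (card B - p - k)"
proof -
  have "(\<Prod>i<m. real m - real i) = fact m" for m
    by (simp add: fact_prod_rev atLeast0LessThan of_nat_diff cong: prod.cong_simp)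
  moreover have rising: "(\<Prod>i<m. real M + 1 + real i) * fact M = fact (M + m)" for M m
  proof (induction m)
    case (Suc m)
    have "(\<Prod>i<Suc m. real M + 1 + real i) * fact M =
        ((\<Prod>i<m. real M + 1 + real i) * fact M) * (real M + 1 + real m)" by (simp add: mult_ac)
    then show ?case unfolding Suc.IH by (simp add: algebra_simps)
  qed simp
  \<comment> \<open>The factors rise from \<open>n - p - k + 1\<close> to
    \<open>n - 2k\<close>.\<close>
  moreover have "(\<Prod>i<p - k. nB - 2 * real k - real (p - k) + 1 + real i) =
      fact (card B - 2 * k) / fact (card B - p - k)"
  proof -
    have "card B - p - k + (p - k) = card B - 2 * k"
      and "real (card B - p - k) = nB - 2 * real k - real (p - k)"
      using assms by (simp_all add: of_nat_diff)
    then show ?thesis using rising[of "card B - p - k" "p - k"]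
      by (simp only: eq_divide_eq fact_nonzero not_False_eq_True if_True)
  qed
  ultimately show ?thesis by (simp only: prod.distrib times_divide_eq_right)
qed

text \<open>Contracting \<open>p - k\<close> times kills the components of index above
  \<open>k\<close>, turns the one of index \<open>k\<close> into a multiple of \<open>w k\<close>,
  and leaves multiples of the metric from the lower ones. These are killed by
  \<open>eff_proj k\<close>, as \<open>2k \<le> p + k \<le> n\<close>.\<close>

lemma eff_proj_contr_pow:
  assumes w: "\<And>j. j \<le> p \<Longrightarrow> w j \<in> effective_forms B j j"
    and \<omega>: "\<omega> = (\<lambda>xs ys. \<Sum>j\<le>p. (g_mult ^^ (p - j)) (w j) xs ys)"
    and k: "k \<le> p" "p + k \<le> card B"
  shows "eff_proj k ((contr ^^ (p - k)) \<omega>) =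
    (\<lambda>xs ys. fact (p - k) * fact (card B - 2 * k) / fact (card B - p - k) * w k xs ys)"
proof (intro ext)
  fix xs ys
  define a where "a j = (\<Prod>i<p - k. (real (p - j) - real i) *
      (nB - 2 * real j - real (p - j) + 1 + real i))" for j
  have w': "w j \<in> dfm j" "contr (w j) = (\<lambda>xs ys. 0)" if "j \<le> p" for j
    using w[OF that] by (auto simp: effective_forms_def)
  have "(contr ^^ (p - k)) \<omega> = (\<lambda>xs ys. \<Sum>j\<le>p. (contr ^^ (p - k)) ((g_mult ^^ (p - j)) (w j)) xs ys)"
    unfolding \<omega>
    using dform_linear_sum[OF linear_contr_pow, of _ "\<lambda>_. 1" "\<lambda>j. (g_mult ^^ (p - j)) (w j)" "{..p}"]
    by simp
  also have "\<dots> =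
      (\<lambda>xs ys. \<Sum>j\<le>p. a j * (g_mult ^^ ((p - j) - (p - k))) (w j) xs ys)"
    using contr_pow_g_pow_effective[OF w']
    by (intro ext sum.cong refl) (simp only: a_def atMost_iff)
  finally have contr_\<omega>: "(contr ^^ (p - k)) \<omega> =
      (\<lambda>xs ys. \<Sum>j\<le>p. a j * (g_mult ^^ ((p - j) - (p - k))) (w j) xs ys)" .
  have "eff_proj k ((contr ^^ (p - k)) \<omega>) xs ys =
      (\<Sum>j\<le>p. a j * eff_proj k ((g_mult ^^ ((p - j) - (p - k))) (w j)) xs ys)"
    unfolding contr_\<omega> dform_linear_sum[OF linear_eff_proj] ..
  also have "\<dots> = (\<Sum>j\<le>p. if j = k then a k * w k xs ys else 0)"
  proof (intro sum.cong refl)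
    fix j assume "j \<in> {..p}"
    then have j: "j \<le> p" by simp
    consider "j = k" | "k < j" | "j < k" by linarith
    then show "a j * eff_proj k ((g_mult ^^ ((p - j) - (p - k))) (w j)) xs ys =
        (if j = k then a k * w k xs ys else 0)"
    proof cases
      case 1
      then show ?thesis by (simp add: eff_proj_effective w' k)
    next
      case 2
      then have "a j = 0" unfolding a_def using j k by (intro prod_falling_eq_0) simp
      then show ?thesis using 2 by simp
    next
      case 3
      \<comment> \<open>The exponent left over is \<open>k - j\<close>, which is positive; one
        factor is set aside for \<open>eff_proj_g\<close>.\<close>
      define d where "d = k - Suc j"
      have "(p - j) - (p - k) = Suc d" "k = Suc (j + d)" using 3 k by (auto simp: d_def)
      then have "eff_proj k ((g_mult ^^ ((p - j) - (p - k))) (w j)) = (\<lambda>xs ys. 0)"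
        using eff_proj_g[OF g_pow_dfm[OF w'(1)[OF j], of d]] k by simp
      then show ?thesis using 3 by simp
    qed
  qed
  also have "\<dots> = a k * w k xs ys" using k by simp
  finally show "eff_proj k ((contr ^^ (p - k)) \<omega>) xs ys =
      fact (p - k) * fact (card B - 2 * k) / fact (card B - p - k) * w k xs ys"
    unfolding a_def prod_effective_coeff[OF k] .
qed

lemma eff_proj_contr_pow_eq:
  "eff_proj k ((contr ^^ m) \<omega>) = (\<lambda>xs ys. (contr ^^ m) \<omega> xs ys +
     (\<Sum>r=1..k. (-1) ^ r / (\<Prod>i=0..r-1. nB - 2 * real k + 2 + real i) *
        (dform_mult (metric_power B r) ((contr ^^ (m + r)) \<omega>) xs ys / fact r)))"
proof (intro ext)
  fix xs ys
  have "(\<Sum>r=1..k. (-1) ^ r / (\<Prod>i=0..r-1. nB - 2 * real k + 2 + real i) *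
        (dform_mult (metric_power B r) ((contr ^^ (m + r)) \<omega>) xs ys / fact r)) =
    (\<Sum>r=1..k. proj_coeff (nB - 2 * real k) r * (g_mult ^^ r) ((contr ^^ r) ((contr ^^ m) \<omega>)) xs ys)"
  proof (intro sum.cong refl)
    fix r assume "r \<in> {1..k}"
    \<comment> \<open>This depends on \<open>1 \<le> r\<close>; the term for \<open>r = 0\<close>
      stands outside the sum.\<close>
    then have "{0..r - 1} = {..<r}" by auto
    moreover have "(contr ^^ (m + r)) \<omega> = (contr ^^ r) ((contr ^^ m) \<omega>)"
      by (simp add: add.commute[of m] funpow_add)
    ultimately show "(-1) ^ r / (\<Prod>i=0..r-1. nB - 2 * real k + 2 + real i) *
        (dform_mult (metric_power B r) ((contr ^^ (m + r)) \<omega>) xs ys / fact r) =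
      proj_coeff (nB - 2 * real k) r * (g_mult ^^ r) ((contr ^^ r) ((contr ^^ m) \<omega>)) xs ys"
      by (simp add: proj_coeff_def dform_mult_metric_power)
  qed
  then show "eff_proj k ((contr ^^ m) \<omega>) xs ys = (contr ^^ m) \<omega> xs ys +
     (\<Sum>r=1..k. (-1) ^ r / (\<Prod>i=0..r-1. nB - 2 * real k + 2 + real i) *
        (dform_mult (metric_power B r) ((contr ^^ (m + r)) \<omega>) xs ys / fact r))"
    by (simp add: eff_proj_def atMost_atLeast0 sum.atLeast_Suc_atMost)
qed

end

text \<open>For \<open>n < p + k\<close> the factorial of \<open>n - p - k\<close> has no meaning in
  the formula, but there \<open>g^(p-k)\<close> vanishes on effective forms of degree
  \<open>k\<close>, so the component can be chosen to be 0.\<close>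

theorem theorem3p7:
  fixes B :: "'a::real_inner set" and n p :: nat
  assumes "orthonormal_basis B" and "n = dim (UNIV :: 'a set)"
  shows
    "(\<forall>j\<le>p. \<forall>k\<le>p. j \<noteq> k \<longrightarrow>
        (\<forall>\<eta>\<in>dform_mult (metric_power B (p - j)) ` effective_forms B j j.
         \<forall>\<theta>\<in>dform_mult (metric_power B (p - k)) ` effective_forms B k k.
           dform_inner B p p \<eta> \<theta> = 0)) \<and>
     double_forms p p =
       {(\<lambda>xs ys. \<Sum>k\<le>p. \<eta> k xs ys) | \<eta>.
          \<forall>k\<le>p. \<eta> k \<in> dform_mult (metric_power B (p - k)) ` effective_forms B k k} \<and>
     (\<forall>\<omega>\<in>double_forms p p. \<exists>w :: nat \<Rightarrow> 'a double_form.
        (\<forall>k\<le>p. w k \<in> effective_forms B k k) \<and>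
        \<omega> = (\<lambda>xs ys. \<Sum>k\<le>p. dform_mult (metric_power B (p - k)) (w k) xs ys) \<and>
        (\<forall>k\<le>p. p + k \<le> n \<longrightarrow>
           w k = (\<lambda>xs ys.
             fact (n - p - k) / (fact (p - k) * fact (n - 2 * k)) *
             ((contraction B ^^ (p - k)) \<omega> xs ys +
              (\<Sum>r=1..k. (-1) ^ r / (\<Prod>i=0..r-1. real n - 2 * real k + 2 + real i) *
                 (dform_mult (metric_power B r) ((contraction B ^^ (p - k + r)) \<omega>) xs ys / fact r))))) \<and>
        (\<forall>k\<le>p. n < p + k \<longrightarrow> w k = (\<lambda>xs ys. 0)))"
proof -
  interpret euclidean_basis B by standard (rule assms(1))
  have n: "n = card B" using assms(2) card_B by simp
  have eff: "(g_mult ^^ (p - k)) w \<in> dfm p" if "w \<in> effective_forms B k k" "k \<le> p" for k w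
    using g_pow_dfm[of w k "p - k"] that by (simp add: effective_forms_def)
  have orth: "dform_inner B p p \<eta> \<theta> = 0"
    if "j \<le> p" "k \<le> p" "j \<noteq> k" "\<eta> \<in> dform_mult (metric_power B (p - j)) ` effective_forms B j j"
      "\<theta> \<in> dform_mult (metric_power B (p - k)) ` effective_forms B k k" for j k \<eta> \<theta>
    using that dform_inner_summands by (auto simp: dform_mult_metric_power)
  have decomp: "double_forms p p = {(\<lambda>xs ys. \<Sum>k\<le>p. \<eta> k xs ys) | \<eta>.
      \<forall>k\<le>p. \<eta> k \<in> dform_mult (metric_power B (p - k)) ` effective_forms B k k}" (is "_ = ?R")
  proof
    show "double_forms p p \<subseteq> ?R"
    proof
      fix \<omega> :: "'a double_form" assume "\<omega> \<in> double_forms p p"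
      then obtain w where "\<forall>k\<le>p. w k \<in> effective_forms B k k"
        "\<omega> = (\<lambda>xs ys. \<Sum>k\<le>p. (g_mult ^^ (p - k)) (w k) xs ys)"
        using dform_decomposition by blast
      then show "\<omega> \<in> ?R"
        unfolding mem_Collect_eq dform_mult_metric_power
        by (intro exI[of _ "\<lambda>k. (g_mult ^^ (p - k)) (w k)"]) auto
    qed
    show "?R \<subseteq> double_forms p p"
      using eff by (auto simp: dform_mult_metric_power intro!: double_forms_sum)
  qed
  have repr: "\<exists>w. (\<forall>k\<le>p. w k \<in> effective_forms B k k) \<and>
        \<omega> = (\<lambda>xs ys. \<Sum>k\<le>p. dform_mult (metric_power B (p - k)) (w k) xs ys) \<and>
        (\<forall>k\<le>p. p + k \<le> n \<longrightarrow>
           w k = (\<lambda>xs ys.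
             fact (n - p - k) / (fact (p - k) * fact (n - 2 * k)) *
             ((contraction B ^^ (p - k)) \<omega> xs ys +
              (\<Sum>r=1..k. (-1) ^ r / (\<Prod>i=0..r-1. real n - 2 * real k + 2 + real i) *
                 (dform_mult (metric_power B r) ((contraction B ^^ (p - k + r)) \<omega>) xs ys / fact r))))) \<and>
        (\<forall>k\<le>p. n < p + k \<longrightarrow> w k = (\<lambda>xs ys. 0))"
    if \<omega>_dfm: "\<omega> \<in> double_forms p p" for \<omega> :: "'a double_form"
  proof -
    obtain v where v: "\<And>k. k \<le> p \<Longrightarrow> v k \<in> effective_forms B k k"
      and \<omega>: "\<omega> = (\<lambda>xs ys. \<Sum>k\<le>p. (g_mult ^^ (p - k)) (v k) xs ys)"
      using dform_decomposition[OF \<omega>_dfm] by blast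
    \<comment> \<open>A component with \<open>n < p + k\<close> may be nonzero, but its product with
      \<open>g^(p-k)\<close> is 0, so replacing it by 0 leaves the sum unchanged.\<close>
    define w where "w k = (if n < p + k then (\<lambda>xs ys. 0) else v k)" for k
    have w: "w k \<in> effective_forms B k k" if "k \<le> p" for k
      using v[OF that]
      by (simp add: w_def effective_forms_def double_forms_zero dform_linear_zero[OF linear_contr])
    have "(g_mult ^^ (p - k)) (v k) = (g_mult ^^ (p - k)) (w k)" if "k \<le> p" for k
      using g_pow_effective_eq_0[of "v k" k p] v[OF that] that
      by (auto simp: w_def effective_forms_def n dform_linear_zero[OF linear_g_pow])
    then have \<omega>': "\<omega> = (\<lambda>xs ys. \<Sum>k\<le>p. (g_mult ^^ (p - k)) (w k) xs ys)"
      unfolding \<omega> by (intro ext sum.cong refl) auto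
    have "w k = (\<lambda>xs ys. fact (n - p - k) / (fact (p - k) * fact (n - 2 * k)) *
        eff_proj k ((contr ^^ (p - k)) \<omega>) xs ys)" if "k \<le> p" "p + k \<le> n" for k
    proof -
      have "eff_proj k ((contr ^^ (p - k)) \<omega>) =
          (\<lambda>xs ys. fact (p - k) * fact (card B - 2 * k) / fact (card B - p - k) * w k xs ys)"
        by (rule eff_proj_contr_pow[OF w \<omega>' that[unfolded n]])
      then show ?thesis unfolding n by (intro ext) simp
    qed
    \<comment> \<open>Written out, \<open>eff_proj\<close> becomes the bracket in the stated
      formula.\<close>
    note this[unfolded eff_proj_contr_pow_eq, folded n]
    moreover have "\<omega> = (\<lambda>xs ys. \<Sum>k\<le>p. dform_mult (metric_power B (p - k)) (w k) xs ys)"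
      unfolding dform_mult_metric_power by (rule \<omega>')
    moreover have "w k = (\<lambda>xs ys. 0)" if "n < p + k" for k
      using that by (simp add: w_def)
    ultimately show ?thesis using w by (intro exI[of _ w] conjI allI impI) assumption+
  qed
  show ?thesis
  proof (intro conjI allI ballI impI, goal_cases)
    case (1 j k \<eta> \<theta>)
    then show ?case by (rule orth)
  next
    case 2
    show ?case by (rule decomp)
  next
    case (3 \<omega>)
    then show ?case by (rule repr)
  qed
qed

end
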